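(* Let $[a,b]$ be a compact interval, $\varepsilon_0>0$, and for every $\varepsilon\in[0,\varepsilon_0]$ let $q_\varepsilon\in L_2([a,b],\mathbb{C})$ and $\alpha(\varepsilon),\beta(\varepsilon)\in\mathbb{C}^{2\times 2}$. Let $L_\varepsilon$ be the operator in $L_2=L_2([a,b],\mathbb{C})$ generated by the formal expression $-y''+q_\varepsilon' y$ (understood via quasi-derivatives) and the boundary conditions $\alpha(\varepsilon)\mathcal{Y}_a(\varepsilon)+\beta(\varepsilon)\mathcal{Y}_b(\varepsilon)=0$, as defined in the context. Suppose that the resolvent set of $L_0$ is not empty and that, as $\varepsilon\to+0$: 1) $\|q_\varepsilon\|_2=O(1)$; 2) $\|(q_\varepsilon-q_0)^\vee\|_C\to 0$; 3) $\|(q_\varepsilon^2-q_0^2)^\vee\|_C\to 0$; 4) $\alpha(\varepsilon)\to\alpha(0)$ and $\beta(\varepsilon)\to\beta(0)$. Then $L_\varepsilon$ converges to $L_0$ in the sense of norm resolvent convergence as $\varepsilon\to+0$.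
   Context: Notation: $\|\cdot\|_2$ is the norm of $L_2=L_2([a,b],\mathbb{C})$; $c^\vee(t):=\int_a^t c(x)\,dx$ for integrable $c$ on $[a,b]$; $\|\cdot\|_C$ is the sup-norm on $[a,b]$. Quasi-derivatives: for $q_\varepsilon\in L_2$ put $$D^{[0]}_\varepsilon y=y,\qquad D^{[1]}_\varepsilon y=y'-q_\varepsilon y,\qquad D^{[2]}_\varepsilon y=-(D^{[1]}_\varepsilon y)'-q_\varepsilon D^{[1]}_\varepsilon y-q_\varepsilon^2 y.$$ Here $D^{[2]}_\varepsilon y$ exists when $y$ and $D^{[1]}_\varepsilon y$ are absolutely continuous on $[a,b]$. The formal expression $l_\varepsilon(y)=-y''+q_\varepsilon' y$ is defined as $l_\varepsilon(y):=D^{[2]}_\varepsilon y$. Operator: $L_\varepsilon y:=l_\varepsilon(y)=D^{[2]}_\varepsilon y$ with domain $$\mathrm{Dom}(L_\varepsilon)=\{y\in L_2:\ \exists\, D^{[2]}_\varepsilon y\in L_2,\ \alpha(\varepsilon)\mathcal{Y}_a(\varepsilon)+\beta(\varepsilon)\mathcal{Y}_b(\varepsilon)=0\},$$ where $\mathcal{Y}_a(\varepsilon)=(y(a),D^{[1]}_\varepsilon y(a))$ and $\mathcal{Y}_b(\varepsilon)=(y(b),D^{[1]}_\varepsilon y(b))$ are viewed as column vectors in $\mathbb{C}^2$. Norm resolvent convergence of $L_\varepsilon$ to $L_0$ as $\varepsilon\to+0$ means: there is $\mu\in\mathbb{C}$ with $\mu\in\rho(L_0)$ and $\mu\in\rho(L_\varepsilon)$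 for all sufficiently small $\varepsilon>0$, such that $\|(L_\varepsilon-\mu)^{-1}-(L_0-\mu)^{-1}\|\to 0$ as $\varepsilon\to+0$ (operator norm on $L_2$; $\rho(\cdot)$ denotes the resolvent set). *)

theory Defs
  imports "HOL-Analysis.Analysis" "HOL-Library.Landau_Symbols"
begin

(* Elements of the space L2([a,b]) are handled through representatives: functions on the reals of
   which only the values on [a,b] matter, up to equality almost everywhere on [a,b]. *)

definition ae_eq_on :: "real \<Rightarrow> real \<Rightarrow> (real \<Rightarrow> complex) \<Rightarrow> (real \<Rightarrow> complex) \<Rightarrow> bool" where
  "ae_eq_on a b f g \<longleftrightarrow> (AE x in lebesgue_on {a..b}. f x = g x)"

definition L2_on :: "real \<Rightarrow> real \<Rightarrow> (real \<Rightarrow> complex) set" where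
  "L2_on a b = {f. f \<in> borel_measurable (lebesgue_on {a..b}) \<and>
                   integrable (lebesgue_on {a..b}) (\<lambda>x. (norm (f x))\<^sup>2)}"

definition L2_norm_on :: "real \<Rightarrow> real \<Rightarrow> (real \<Rightarrow> complex) \<Rightarrow> real" where
  "L2_norm_on a b f = sqrt (LINT x|lebesgue_on {a..b}. (norm (f x))\<^sup>2)"

definition antideriv :: "real \<Rightarrow> (real \<Rightarrow> complex) \<Rightarrow> real \<Rightarrow> complex" where
  "antideriv a c t = (LINT x:{a..t}|lebesgue. c x)"

definition sup_norm_on :: "real \<Rightarrow> real \<Rightarrow> (real \<Rightarrow> complex) \<Rightarrow> real" where
  "sup_norm_on a b f = (SUP t\<in>{a..b}. norm (f t))"

(* The usual epsilon-delta notion: a division of a set T is a finite family of nonoverlapping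
   compact intervals with union T. *)
definition abs_cont_on :: "real \<Rightarrow> real \<Rightarrow> (real \<Rightarrow> complex) \<Rightarrow> bool" where
  "abs_cont_on a b f \<longleftrightarrow>
     (\<forall>e>0. \<exists>d>0. \<forall>\<D> T. \<D> division_of T \<and> T \<subseteq> {a..b} \<and> (\<Sum>K\<in>\<D>. Sup K - Inf K) < d \<longrightarrow>
        (\<Sum>K\<in>\<D>. norm (f (Sup K) - f (Inf K))) < e)"

(* y is absolutely continuous and D[1] y = y' - q y exists and is absolutely continuous. As y' is
   defined only almost everywhere, u stands for the absolutely continuous representative of D[1] y,
   which is unique on [a,b]; its values at a and b enter the boundary conditions. *)
definition has_quasi_deriv1 ::
  "real \<Rightarrow> real \<Rightarrow> (real \<Rightarrow> complex) \<Rightarrow> (real \<Rightarrow> complex) \<Rightarrow> (real \<Rightarrow> complex) \<Rightarrow> bool" where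
  "has_quasi_deriv1 a b q y u \<longleftrightarrow>
     abs_cont_on a b y \<and> abs_cont_on a b u \<and>
     (AE x in lebesgue_on {a..b}.
        \<exists>y'. (y has_vector_derivative y') (at x within {a..b}) \<and> u x = y' - q x * y x)"

(* v = D[2] y, where u = D[1] y. *)
definition has_quasi_deriv2 ::
  "real \<Rightarrow> real \<Rightarrow> (real \<Rightarrow> complex) \<Rightarrow> (real \<Rightarrow> complex) \<Rightarrow> (real \<Rightarrow> complex) \<Rightarrow> (real \<Rightarrow> complex) \<Rightarrow> bool"
  where
  "has_quasi_deriv2 a b q y u v \<longleftrightarrow>
     has_quasi_deriv1 a b q y u \<and>
     (AE x in lebesgue_on {a..b}.
        \<exists>u'. (u has_vector_derivative u') (at x within {a..b}) \<and>
             v x = - u' - q x * u x - (q x)\<^sup>2 * y x)"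

(* Operators in L2([a,b]) are given by their graphs, saturated under equality almost everywhere. *)
type_synonym L2_operator = "((real \<Rightarrow> complex) \<times> (real \<Rightarrow> complex)) set"

(* The graph of L: y ranges over the elements of L2 having a representative w on which the
   quasi-derivatives and the boundary conditions make sense. *)
definition SL_operator ::
  "real \<Rightarrow> real \<Rightarrow> (real \<Rightarrow> complex) \<Rightarrow> complex^2^2 \<Rightarrow> complex^2^2 \<Rightarrow> L2_operator" where
  "SL_operator a b q \<alpha> \<beta> =
     {(y, v). y \<in> L2_on a b \<and> v \<in> L2_on a b \<and>
        (\<exists>w u. ae_eq_on a b y w \<and> has_quasi_deriv2 a b q w u v \<and>
               \<alpha> *v vector [w a, u a] + \<beta> *v vector [w b, u b] = 0)}"

(* (T - mu) y = f in L2([a,b]) *)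
definition resolvent_eq ::
  "real \<Rightarrow> real \<Rightarrow> L2_operator \<Rightarrow> complex \<Rightarrow> (real \<Rightarrow> complex) \<Rightarrow> (real \<Rightarrow> complex) \<Rightarrow> bool" where
  "resolvent_eq a b T \<mu> f y \<longleftrightarrow> (\<exists>v. (y, v) \<in> T \<and> ae_eq_on a b (\<lambda>x. v x - \<mu> * y x) f)"

(* T - mu maps Dom(T) bijectively onto L2([a,b]) and has a bounded inverse. *)
definition resolvent_set_on :: "real \<Rightarrow> real \<Rightarrow> L2_operator \<Rightarrow> complex set" where
  "resolvent_set_on a b T = {\<mu>.
     (\<forall>f\<in>L2_on a b. \<exists>y. resolvent_eq a b T \<mu> f y) \<and>
     (\<forall>f\<in>L2_on a b. \<forall>y z. resolvent_eq a b T \<mu> f y \<and> resolvent_eq a b T \<mu> f z \<longrightarrow> ae_eq_on a b y z) \<and>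
     (\<exists>C. \<forall>f\<in>L2_on a b. \<forall>y. resolvent_eq a b T \<mu> f y \<longrightarrow> L2_norm_on a b y \<le> C * L2_norm_on a b f)}"

(* For mu in the resolvent set, a representative of (T - mu)^{-1} f; the choice is unique up to
   equality almost everywhere. *)
definition resolvent_on ::
  "real \<Rightarrow> real \<Rightarrow> L2_operator \<Rightarrow> complex \<Rightarrow> (real \<Rightarrow> complex) \<Rightarrow> real \<Rightarrow> complex" where
  "resolvent_on a b T \<mu> f = (SOME y. resolvent_eq a b T \<mu> f y)"

(* Taken in the extended nonnegative reals, so that an unbounded map has norm infinity. *)
definition L2_opnorm ::
  "real \<Rightarrow> real \<Rightarrow> ((real \<Rightarrow> complex) \<Rightarrow> real \<Rightarrow> complex) \<Rightarrow> ennreal" where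
  "L2_opnorm a b R = (SUP f\<in>{f \<in> L2_on a b. L2_norm_on a b f \<le> 1}. ennreal (L2_norm_on a b (R f)))"

definition norm_resolvent_convergent ::
  "real \<Rightarrow> real \<Rightarrow> (real \<Rightarrow> L2_operator) \<Rightarrow> L2_operator \<Rightarrow> bool" where
  "norm_resolvent_convergent a b L L0 \<longleftrightarrow>
     (\<exists>\<mu>. \<mu> \<in> resolvent_set_on a b L0 \<and>
          (\<forall>\<^sub>F \<epsilon> in at_right 0. \<mu> \<in> resolvent_set_on a b (L \<epsilon>)) \<and>
          ((\<lambda>\<epsilon>. L2_opnorm a b (\<lambda>f x. resolvent_on a b (L \<epsilon>) \<mu> f x - resolvent_on a b L0 \<mu> f x))
             \<longlongrightarrow> 0) (at_right 0))"

end

theory Submission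
  imports Defs
begin

text \<open>
  With \<open>Y = (y, D[1] y)\<close> the equation \<open>(L - \<mu>) y = f\<close> becomes the first-order system
  \<open>Y' = A Y + (0, - f)\<close> with the integrable coefficient matrix \<open>A = ((q, 1), (- q^2 - \<mu>, - q))\<close>.
  Conditions 1 to 3 say that the \<open>L1\<close> norms of the matrices \<open>A\<^sub>\<epsilon>\<close> stay bounded and that the antiderivatives
  of \<open>A\<^sub>\<epsilon> - A\<^sub>0\<close> tend to 0 uniformly. The difference of two solutions with the same initial value solves
  a system with matrix \<open>A\<^sub>\<epsilon>\<close> and source \<open>(A\<^sub>\<epsilon> - A\<^sub>0) Y\<^sub>0\<close>; integration by parts bounds the antiderivative of
  this source by that of \<open>A\<^sub>\<epsilon> - A\<^sub>0\<close>, and Gronwall's inequality concludes that it is small relative to the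
  data. As \<open>\<mu>\<close> is a resolvent point of \<open>L\<^sub>0\<close>, the map taking an initial value to the boundary form of the
  homogeneous solution is invertible for \<open>\<epsilon> = 0\<close>, hence uniformly invertible for small \<open>\<epsilon>\<close>, and this carries
  the estimate over to the solutions of the boundary value problems.
\<close>

hide_const (open) Polynomial.content

section \<open>Differentiation of indefinite integrals and absolute continuity\<close>

text \<open>The obstacle is that \<open>A\<^sub>\<epsilon> - A\<^sub>0\<close> need not be small in
  L1: rapid oscillations of the potentials are allowed, and only their antiderivatives vanish in the
  limit. A Gronwall estimate that takes norms inside all integrals would lose this smallness. Hence
  the source is integrated before any norm is taken, and the difference of the coefficients is
  attached to the limit solution \<open>Y\<^sub>0\<close>, whose derivative has an L1 norm
  controlled by the data. Every constant multiplies the L1 norm of the right-hand side, hence its L2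
  norm; this uniformity yields convergence in operator norm and not merely strong convergence.
  Solutions are only absolutely continuous, with derivatives known almost everywhere. The calculus
  is therefore set up for integrable functions: differentiation of indefinite integrals comes from a
  Vitali covering argument, the fundamental theorem for absolutely continuous functions from a
  choice of gauge, and integration by parts from the two together.\<close>

lemma has_vector_derivative_within_iff_small_o:
  fixes f :: "real \<Rightarrow> 'a::real_normed_vector"
  shows "(f has_vector_derivative D) (at x within S) \<longleftrightarrow>
    (\<forall>e>0. \<exists>d>0. \<forall>y\<in>S. \<bar>y - x\<bar> < d \<longrightarrow> norm (f y - f x - (y - x) *\<^sub>R D) \<le> e * \<bar>y - x\<bar>)"
  unfolding has_vector_derivative_def has_derivative_within_alt
  by (auto simp: bounded_linear_scaleR_left)

lemma integral_interval_diff: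
  fixes f :: "real \<Rightarrow> 'a::banach"
  assumes "f integrable_on {a..b}" "a \<le> x" "x \<le> y" "y \<le> b"
  shows "integral {x..y} f = integral {a..y} f - integral {a..x} f"
proof -
  have "f integrable_on {a..y}" using assms by (auto intro: integrable_on_subinterval)
  thus ?thesis
    using Henstock_Kurzweil_Integration.integral_combine[of a x y f] assms by (simp add: algebra_simps)
qed

text \<open>Henstock's lemma, applied to finite disjoint subfamilies of a Vitali covering.\<close>
lemma negligible_indefinite_integral_deviation:
  fixes f :: "real \<Rightarrow> 'a::euclidean_space"
  assumes f: "f integrable_on {a..b}" and e: "e > 0"
  shows "negligible {x \<in> {a..b}. \<forall>d>0. \<exists>y\<in>{a..b}. \<bar>y - x\<bar> < d \<and>
           norm (integral {a..y} f - integral {a..x} f - (y - x) *\<^sub>R f x) > e * \<bar>y - x\<bar>}"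
    (is "negligible ?E")
  unfolding negligible_outer_le
proof (intro allI impI)
  fix \<eta> :: real assume "\<eta> > 0"
  with e have "e * \<eta> > 0" by simp
  \<comment> \<open>Why \<open>e * \<eta>\<close>: each interval used below contributes more than
    \<open>e\<close> times its length to the Henstock sum, so the lengths add up to at most
    \<open>\<eta>\<close>.\<close>
  obtain \<gamma> where \<gamma>: "gauge \<gamma>"
    and fine: "\<And>p. \<lbrakk>p tagged_partial_division_of (cbox a b); \<gamma> fine p\<rbrakk> \<Longrightarrow>
             (\<Sum>(x,k)\<in>p. norm (content k *\<^sub>R f x - integral k f)) < e * \<eta>"
    by (rule Henstock_lemma[OF f[folded box_real] \<open>e * \<eta> > 0\<close>]) (rule that)
  \<comment> \<open>The bad point \<open>x\<close> is the tag and an endpoint of its interval; the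
    witness \<open>y\<close> may lie on either side, hence \<open>min\<close> and
    \<open>max\<close>. All intervals respect the gauge, and witnesses exist arbitrarily close to
    \<open>x\<close>, so the family is a Vitali covering of the exceptional set.\<close>
  define K where "K = {(x,y). x \<in> ?E \<and> y \<in> {a..b} \<and> x \<noteq> y \<and> {min x y..max x y} \<subseteq> \<gamma> x \<and>
       norm (integral {a..y} f - integral {a..x} f - (y - x) *\<^sub>R f x) > e * \<bar>y - x\<bar>}"
  define c where "c = (\<lambda>(x::real,y). (x + y) / 2)"
  define r where "r = (\<lambda>(x::real,y). \<bar>y - x\<bar> / 2)"
  have cb: "cball (c (x,y)) (r (x,y)) = {min x y..max x y}" for x y
    unfolding c_def r_def cball_eq_atLeastAtMost by (auto simp: min_def max_def field_simps)
  obtain C where C: "countable C" "C \<subseteq> K"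
     "pairwise (\<lambda>i j. disjnt (cball (c i) (r i)) (cball (c j) (r j))) C"
     "negligible (?E - (\<Union>i \<in> C. cball (c i) (r i)))"
  proof (rule Vitali_covering_theorem_cballs[of K r ?E c])
    show "0 < r i" if "i \<in> K" for i using that by (auto simp: K_def r_def)
    fix x d :: real assume x: "x \<in> ?E" and "0 < d"
    obtain d' where d': "d' > 0" "ball x d' \<subseteq> \<gamma> x"
      using \<gamma> unfolding gauge_def by (meson openE)
    obtain y where y: "y \<in> {a..b}" "\<bar>y - x\<bar> < min d d'"
      "norm (integral {a..y} f - integral {a..x} f - (y - x) *\<^sub>R f x) > e * \<bar>y - x\<bar>"
    proof -
      have "min d d' > 0" using \<open>0 < d\<close> d'(1) by simp
      thus ?thesis using x that by blast
    qed
    have "y \<noteq> x" using y(3) by auto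
    have "{min x y..max x y} \<subseteq> ball x d'" using y(2) by (auto simp: dist_real_def)
    hence "(x,y) \<in> K" using x y d' \<open>y \<noteq> x\<close> unfolding K_def by blast
    moreover have "x \<in> cball (c (x,y)) (r (x,y))" unfolding cb by auto
    moreover have "r (x,y) < d" using y(2) by (auto simp: r_def)
    ultimately show "\<exists>i. i \<in> K \<and> x \<in> cball (c i) (r i) \<and> r i < d" by blast
  qed
  let ?I = "\<lambda>i. cball (c i) (r i)"
  have le: "measure lebesgue (\<Union>i\<in>I'. ?I i) \<le> \<eta>" if "I' \<subseteq> C" "finite I'" for I'
  proof -
    define p where "p = (\<lambda>i. (fst i, ?I i)) ` I'"
    have I'K: "I' \<subseteq> K" using that C by blast
    have disj: "disjnt (?I i) (?I j)" if "i \<in> I'" "j \<in> I'" "i \<noteq> j" for i j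
      using C(3) that \<open>I' \<subseteq> C\<close> by (meson pairwiseD subsetD)
    have rpos: "r i > 0" if "i \<in> I'" for i using that I'K by (auto simp: K_def r_def)
    have inj: "inj_on (\<lambda>i. (fst i, ?I i)) I'"
    proof (rule inj_onI)
      fix i j assume ij: "i \<in> I'" "j \<in> I'" "(fst i, ?I i) = (fst j, ?I j)"
      hence "?I i = ?I j" by simp
      moreover have "?I i \<noteq> {}" using rpos[OF ij(1)] by auto
      ultimately have "\<not> disjnt (?I i) (?I j)" by (auto simp: disjnt_def)
      thus "i = j" using disj ij by blast
    qed
    have pE: thesis if "(x,k) \<in> p" "\<And>y. (x,y) \<in> I' \<Longrightarrow> k = {min x y..max x y} \<Longrightarrow> thesis" for x k thesis
    proof -
      obtain i where "i \<in> I'" "x = fst i" "k = ?I i" using \<open>(x,k) \<in> p\<close> unfolding p_def by auto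
      thus ?thesis using that(2)[of "snd i"] cb[of "fst i" "snd i"] by simp
    qed
    have part: "p tagged_partial_division_of (cbox a b)"
      unfolding tagged_partial_division_of_def
    proof (intro conjI allI impI)
      show "finite p" using that by (simp add: p_def)
    next
      fix x k assume "(x,k) \<in> p"
      then obtain y where i: "(x,y) \<in> I'" "k = {min x y..max x y}" by (rule pE)
      hence K: "(x,y) \<in> K" using I'K by blast
      show "x \<in> k" using i by auto
      show "k \<subseteq> cbox a b" using K unfolding i(2) K_def by auto
      show "\<exists>u v. k = cbox u v" using i by (auto simp: box_real)
    next
      fix x1 k1 x2 k2 assume A: "(x1,k1) \<in> p \<and> (x2,k2) \<in> p \<and> (x1,k1) \<noteq> (x2,k2)"
      then obtain i j where "i \<in> I'" "j \<in> I'" "k1 = ?I i" "k2 = ?I j" "i \<noteq> j" unfolding p_def by auto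
      hence "disjnt k1 k2" using disj by blast
      thus "interior k1 \<inter> interior k2 = {}"
        using interior_subset[of k1] interior_subset[of k2] unfolding disjnt_def by blast
    qed
    have "\<gamma> fine p"
    proof (rule fineI)
      fix x k assume "(x,k) \<in> p"
      then obtain y where i: "(x,y) \<in> I'" "k = {min x y..max x y}" by (rule pE)
      thus "k \<subseteq> \<gamma> x" using I'K by (auto simp: K_def)
    qed
    have "e * measure lebesgue (\<Union>i\<in>I'. ?I i) = (\<Sum>i\<in>I'. e * content (?I i))"
      using that disj by (subst measure_UNION') (auto simp: pairwise_def sum_distrib_left)
    also have "\<dots> \<le> (\<Sum>i\<in>I'. norm (content (?I i) *\<^sub>R f (fst i) - integral (?I i) f))"
    proof (rule sum_mono)
      fix i assume "i \<in> I'"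
      obtain x y where i: "i = (x,y)" by (cases i)
      have K: "(x,y) \<in> K" using I'K \<open>i \<in> I'\<close> i by blast
      have xy: "x \<in> {a..b}" "y \<in> {a..b}" and
        gt: "norm (integral {a..y} f - integral {a..x} f - (y - x) *\<^sub>R f x) > e * \<bar>y - x\<bar>"
        using K by (auto simp: K_def)
      show "e * content (?I i) \<le> norm (content (?I i) *\<^sub>R f (fst i) - integral (?I i) f)"
      proof (cases "x \<le> y")
        case True
        have "integral {x..y} f = integral {a..y} f - integral {a..x} f"
          using xy True by (intro integral_interval_diff[OF f]) auto
        thus ?thesis using gt True unfolding i cb
          by (simp add: min_absorb1 max_absorb2 norm_minus_commute)
      next
        case False
        have eq: "integral {y..x} f = integral {a..x} f - integral {a..y} f"
          using xy False by (intro integral_interval_diff[OF f]) auto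
        have "norm ((x - y) *\<^sub>R f x - integral {y..x} f) =
            norm (integral {a..y} f - integral {a..x} f - (y - x) *\<^sub>R f x)"
          unfolding eq by (simp add: algebra_simps)
        thus ?thesis using gt False unfolding i cb by (simp add: min_absorb2 max_absorb1)
      qed
    qed
    also have "\<dots> = (\<Sum>(x,k)\<in>p. norm (content k *\<^sub>R f x - integral k f))"
      unfolding p_def by (simp add: sum.reindex[OF inj])
    also have "\<dots> < e * \<eta>" by (rule fine[OF part \<open>\<gamma> fine p\<close>])
    finally show ?thesis using e by simp
  qed
  define W where "W = (\<Union>i\<in>C. ?I i)"
  define N where "N = ?E - W"
  have W: "W \<in> lmeasurable" "measure lebesgue W \<le> \<eta>" unfolding W_def
    by (rule fmeasurable_UN_bound measure_UN_bound; use C(1) le in auto)+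
  have N: "N \<in> lmeasurable" "measure lebesgue N = 0"
    using C(4) unfolding N_def W_def by (rule negligible_imp_measurable, rule negligible_imp_measure0)
  have "?E \<subseteq> W \<union> N" unfolding N_def by (simp only: Un_Diff_cancel Un_upper2)
  moreover have "W \<union> N \<in> lmeasurable" using W(1) N(1) by (rule fmeasurable.Un)
  moreover have "measure lebesgue (W \<union> N) \<le> \<eta>"
    using W N measure_Un_le[of W lebesgue N] by (simp add: fmeasurableD)
  ultimately show "\<exists>T. ?E \<subseteq> T \<and> T \<in> lmeasurable \<and> measure lebesgue T \<le> \<eta>" by (intro exI[of _ "W \<union> N"] conjI)
qed

text \<open>The Lebesgue differentiation theorem on an interval. Where the derivative fails, it
  fails for some tolerance \<open>e\<close> and then for a smaller \<open>1 / Suc n\<close>, so the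
  exceptional set is covered by countably many null sets.\<close>

theorem negligible_not_indefinite_integral_deriv:
  fixes f :: "real \<Rightarrow> 'a::euclidean_space"
  assumes f: "f integrable_on {a..b}"
  shows "negligible {x \<in> {a..b}.
    \<not> ((\<lambda>t. integral {a..t} f) has_vector_derivative f x) (at x within {a..b})}"
proof -
  let ?E = "\<lambda>e. {x \<in> {a..b}. \<forall>d>0. \<exists>y\<in>{a..b}. \<bar>y - x\<bar> < d \<and>
           norm (integral {a..y} f - integral {a..x} f - (y - x) *\<^sub>R f x) > e * \<bar>y - x\<bar>}"
  have "negligible (\<Union>n. ?E (1 / Suc n))"
    by (rule negligible_Union_nat) (rule negligible_indefinite_integral_deviation[OF f], simp)
  moreover have "{x \<in> {a..b}. \<not> ((\<lambda>t. integral {a..t} f) has_vector_derivative f x) (at x within {a..b})}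
      \<subseteq> (\<Union>n. ?E (1 / Suc n))"
  proof
    fix x assume x: "x \<in> {x \<in> {a..b}. \<not> ((\<lambda>t. integral {a..t} f) has_vector_derivative f x) (at x within {a..b})}"
    then obtain e where e: "e > 0" "\<forall>d>0. \<exists>y\<in>{a..b}. \<bar>y - x\<bar> < d \<and>
           norm (integral {a..y} f - integral {a..x} f - (y - x) *\<^sub>R f x) > e * \<bar>y - x\<bar>"
      unfolding has_vector_derivative_within_iff_small_o by (force simp: not_le)
    obtain n where n: "1 / Suc n < e" using e(1) nat_approx_posE by blast
    have "1 / Suc n * z \<le> e * z" if "z \<ge> 0" for z using n that by (intro mult_right_mono) auto
    hence le: "1 / Suc n * \<bar>y - x\<bar> \<le> e * \<bar>y - x\<bar>" for y by simp
    have "\<forall>d>0. \<exists>y\<in>{a..b}. \<bar>y - x\<bar> < d \<and>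
        norm (integral {a..y} f - integral {a..x} f - (y - x) *\<^sub>R f x) > 1 / Suc n * \<bar>y - x\<bar>"
    proof (intro allI impI)
      fix d :: real assume "d > 0"
      with e(2) obtain y where "y \<in> {a..b}" "\<bar>y - x\<bar> < d"
        "norm (integral {a..y} f - integral {a..x} f - (y - x) *\<^sub>R f x) > e * \<bar>y - x\<bar>" by blast
      thus "\<exists>y\<in>{a..b}. \<bar>y - x\<bar> < d \<and>
        norm (integral {a..y} f - integral {a..x} f - (y - x) *\<^sub>R f x) > 1 / Suc n * \<bar>y - x\<bar>"
        using le[of y] by (intro bexI[of _ y]) auto
    qed
    moreover from x have "x \<in> {a..b}" by simp
    ultimately show "x \<in> (\<Union>n. ?E (1 / Suc n))" by (intro UN_I[of n] CollectI conjI UNIV_I)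
  qed
  ultimately show ?thesis by (rule negligible_subset)
qed

text \<open>A copy of \<open>abs_cont_on\<close> for arbitrary codomains, needed for vector-valued solutions.\<close>
definition ac_on :: "real \<Rightarrow> real \<Rightarrow> (real \<Rightarrow> 'a::real_normed_vector) \<Rightarrow> bool" where
  "ac_on a b f \<longleftrightarrow>
     (\<forall>e>0. \<exists>d>0. \<forall>\<D> T. \<D> division_of T \<and> T \<subseteq> {a..b} \<and> (\<Sum>K\<in>\<D>. Sup K - Inf K) < d \<longrightarrow>
        (\<Sum>K\<in>\<D>. norm (f (Sup K) - f (Inf K))) < e)"

lemma abs_cont_on_iff_ac_on: "abs_cont_on a b f \<longleftrightarrow> ac_on a b f"
  unfolding abs_cont_on_def ac_on_def ..

text \<open>Turns the total length in the definition of absolute continuity into a Lebesgue measure.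
  Members of a division are nonempty, so \<open>Sup K - Inf K\<close> is a true length.\<close>

lemma division_sum_length:
  fixes T :: "real set"
  assumes "\<D> division_of T"
  shows "T \<in> lmeasurable" "(\<Sum>K\<in>\<D>. Sup K - Inf K) = measure lebesgue T"
proof -
  note D = division_ofD[OF assms]
  have "\<Union>\<D> \<in> lmeasurable"
    using D(1) D(4) by (intro fmeasurable.finite_Union) auto
  thus T: "T \<in> lmeasurable" using D(6) by simp
  have "measure lebesgue T = integral T (\<lambda>_. 1)" by (rule lmeasure_integral[OF T])
  also have "\<dots> = (\<Sum>K\<in>\<D>. integral K (\<lambda>_. 1))"
    by (intro integral_combine_division_topdown assms) (use T in \<open>simp add: lmeasurable_iff_integrable_on\<close>)
  also have "\<dots> = (\<Sum>K\<in>\<D>. Sup K - Inf K)"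
  proof (rule sum.cong[OF refl])
    fix K assume "K \<in> \<D>"
    then obtain u v where K: "K = cbox u v" "K \<noteq> {}" using D by metis
    thus "integral K (\<lambda>_. 1) = Sup K - Inf K" by auto
  qed
  finally show "(\<Sum>K\<in>\<D>. Sup K - Inf K) = measure lebesgue T" by simp
qed

text \<open>The gauge keeps intervals tagged in \<open>N\<close> inside an open set of small measure, where absolute continuity
  bounds their contribution.\<close>
theorem ac_on_has_integral:
  fixes f :: "real \<Rightarrow> 'a::euclidean_space"
  assumes "a \<le> b" and ac: "ac_on a b f" and N: "negligible N"
    and deriv: "\<And>x. x \<in> {a..b} - N \<Longrightarrow> (f has_vector_derivative g x) (at x within {a..b})"
  shows "(g has_integral (f b - f a)) {a..b}"
proof -
  \<comment> \<open>The values of \<open>g\<close> on \<open>N\<close> are arbitrary. With 0 in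
    their place, the terms tagged in \<open>N\<close> reduce to increments of
    \<open>f\<close>.\<close>
  define h where "h = (\<lambda>x. if x \<in> N then 0 else g x)"
  have "(h has_integral (f b - f a)) {a..b}"
  proof (cases "a = b")
    case True thus ?thesis using has_integral_refl(2)[of h a] by simp
  next
    case False
    with \<open>a \<le> b\<close> have "a < b" by simp
    show ?thesis unfolding has_integral_factor_content_real
    proof (intro allI impI)
      fix e :: real assume "e > 0"
      with \<open>a < b\<close> have "e / 2 * (b - a) > 0" by simp
      then obtain \<delta> where "\<delta> > 0" and \<delta>:
        "\<And>\<D> T. \<D> division_of T \<Longrightarrow> T \<subseteq> {a..b} \<Longrightarrow> (\<Sum>K\<in>\<D>. Sup K - Inf K) < \<delta> \<Longrightarrow>
            (\<Sum>K\<in>\<D>. norm (f (Sup K) - f (Inf K))) < e / 2 * (b - a)"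
        using ac unfolding ac_on_def by meson
      obtain U where U: "open U" "N \<subseteq> U" "U - N \<in> lmeasurable" "emeasure lebesgue (U - N) < ennreal \<delta>"
        using sets_lebesgue_outer_open[OF negligible_imp_sets[OF N] \<open>\<delta> > 0\<close>] by blast
      have N0: "N \<in> lmeasurable" "measure lebesgue N = 0"
        using N negligible_imp_measurable negligible_imp_measure0 by auto
      have Ueq: "U = (U - N) \<union> N" using U(2) by blast
      have UL: "U \<in> lmeasurable" using U(3) N0 Ueq by (metis fmeasurable.Un)
      have "measure lebesgue U \<le> measure lebesgue (U - N) + measure lebesgue N"
        using U(3) N0 Ueq by (metis fmeasurableD measure_Un_le)
      also have "\<dots> < \<delta>" using U(3,4) N0 \<open>\<delta> > 0\<close> by (simp add: emeasure_eq_measure2 ennreal_less_iff)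
      finally have mU: "measure lebesgue U < \<delta>" .
      have "\<exists>d>0. x \<in> {a..b} - N \<longrightarrow> (\<forall>y\<in>{a..b}. \<bar>y - x\<bar> < d \<longrightarrow>
          norm (f y - f x - (y - x) *\<^sub>R g x) \<le> e/2 * \<bar>y - x\<bar>)" for x
      proof (cases "x \<in> {a..b} - N")
        case True
        thus ?thesis using deriv[OF True] \<open>e > 0\<close> unfolding has_vector_derivative_within_iff_small_o
          by (meson half_gt_zero)
      qed (use zero_less_one in blast)
      then obtain d where d: "\<And>x. d x > 0" "\<And>x y. x \<in> {a..b} - N \<Longrightarrow> y \<in> {a..b} \<Longrightarrow> \<bar>y - x\<bar> < d x \<Longrightarrow>
          norm (f y - f x - (y - x) *\<^sub>R g x) \<le> e/2 * \<bar>y - x\<bar>" by metis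
      define \<gamma> where "\<gamma> = (\<lambda>x. if x \<in> N then U else ball x (d x))"
      have gauge: "gauge \<gamma>" using U(1,2) d(1) by (auto simp: gauge_def \<gamma>_def)
      have bound: "norm ((\<Sum>(x,k)\<in>p. content k *\<^sub>R h x) - (f b - f a)) \<le> e * content {a..b}"
        if p: "p tagged_division_of {a..b}" and fine: "\<gamma> fine p" for p
      proof -
        note P = tagged_division_ofD[OF p]
        let ?t = "\<lambda>(x,k). content k *\<^sub>R h x - (f (Sup k) - f (Inf k))"
        \<comment> \<open>Tags in \<open>N\<close> and tags outside \<open>N\<close> each take half
          of the allowed error: the former through absolute continuity, the latter through the
          derivative.\<close>
        define pN where "pN = {(x,k)\<in>p. x \<in> N}"
        have pN: "pN \<subseteq> p" "finite pN" using P(1) by (auto simp: pN_def intro: finite_subset)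
        have "(\<Sum>(x,k)\<in>p. content k *\<^sub>R h x) - (f b - f a) = (\<Sum>z\<in>p. ?t z)"
          using additive_tagged_division_1[OF \<open>a \<le> b\<close> p, of f]
          by (simp add: sum_subtractf case_prod_unfold)
        also have "\<dots> = (\<Sum>z\<in>p - pN. ?t z) + (\<Sum>z\<in>pN. ?t z)"
          by (rule sum.subset_diff[OF pN(1) P(1)])
        finally have "norm ((\<Sum>(x,k)\<in>p. content k *\<^sub>R h x) - (f b - f a)) \<le>
            norm (\<Sum>z\<in>p - pN. ?t z) + norm (\<Sum>z\<in>pN. ?t z)" by (simp add: norm_triangle_ineq)
        moreover have "norm (\<Sum>z\<in>p - pN. ?t z) \<le> e/2 * (b - a)"
        proof -
          have "norm (\<Sum>z\<in>p - pN. ?t z) \<le> (\<Sum>z\<in>p - pN. e/2 * content (snd z))"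
          proof (rule sum_norm_le)
            fix z assume z: "z \<in> p - pN"
            obtain x k where zk: "z = (x,k)" by (cases z)
            have xk: "(x,k) \<in> p" "x \<notin> N" using z zk by (auto simp: pN_def)
            obtain u v where k: "k = {u..v}" using P(4)[OF xk(1)] by auto
            have ux: "u \<le> x" "x \<le> v" using P(2)[OF xk(1)] k by auto
            have uv: "u \<in> {a..b}" "v \<in> {a..b}" using P(3)[OF xk(1)] k ux by auto
            have "k \<subseteq> ball x (d x)" using fine xk unfolding fine_def \<gamma>_def by fastforce
            moreover have "u \<in> k" "v \<in> k" using k ux by auto
            ultimately have "u \<in> ball x (d x)" "v \<in> ball x (d x)" by blast+
            hence uvd: "\<bar>u - x\<bar> < d x" "\<bar>v - x\<bar> < d x" by (auto simp: dist_real_def)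
            have x: "x \<in> {a..b} - N" using uv ux xk by auto
            \<comment> \<open>The tag lies between the endpoints, so the error on \<open>k\<close>
              splits into two errors measured from \<open>x\<close>, and the two distances add up to
              \<open>v - u\<close>.\<close>
            have "(v - u) *\<^sub>R g x - (f v - f u) =
               (f u - f x - (u - x) *\<^sub>R g x) - (f v - f x - (v - x) *\<^sub>R g x)" by (simp add: algebra_simps)
            hence "norm ((v - u) *\<^sub>R g x - (f v - f u)) \<le> e/2 * \<bar>u - x\<bar> + e/2 * \<bar>v - x\<bar>"
              using d(2)[OF x uv(1) uvd(1)] d(2)[OF x uv(2) uvd(2)] norm_triangle_ineq4 by (smt (verit))
            also have "\<dots> = e/2 * (v - u)" using ux by (simp add: abs_if field_simps)
            finally show "norm (?t z) \<le> e/2 * content (snd z)"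
              using ux xk(2) by (simp add: zk k h_def)
          qed
          also have "\<dots> \<le> (\<Sum>z\<in>p. e/2 * content (snd z))"
            using P(1) \<open>e > 0\<close> by (intro sum_mono2) auto
          also have "\<dots> = e/2 * (b - a)"
            using additive_content_tagged_division[OF p[folded box_real]] \<open>a \<le> b\<close>
            by (simp only: sum_distrib_left[symmetric] case_prod_unfold) simp
          finally show ?thesis .
        qed
        moreover have "norm (\<Sum>z\<in>pN. ?t z) \<le> e/2 * (b - a)"
        proof -
          define T where "T = \<Union>(snd ` pN)"
          have tag: "pN tagged_division_of T" unfolding T_def
            using p pN(1) unfolding tagged_division_of_def[of p]
            by (blast intro: tagged_partial_division_of_Union_self tagged_partial_division_subset)
          have div: "snd ` pN division_of T" by (rule division_of_tagged_division[OF tag])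
          have TU: "T \<subseteq> U" using fine unfolding T_def fine_def \<gamma>_def pN_def by (fastforce split: if_splits)
          have Tab: "T \<subseteq> {a..b}" using P(3) pN(1) unfolding T_def by force
          have "measure lebesgue T \<le> measure lebesgue U"
            using TU UL division_sum_length(1)[OF div] by (intro measure_mono_fmeasurable) auto
          hence "(\<Sum>K\<in>snd ` pN. norm (f (Sup K) - f (Inf K))) < e/2 * (b - a)"
            using mU division_sum_length(2)[OF div] by (intro \<delta>[OF div Tab]) simp
          moreover have "(\<Sum>K\<in>snd ` pN. norm (f (Sup K) - f (Inf K)))
             = (\<Sum>(x,K)\<in>pN. norm (f (Sup K) - f (Inf K)))"
          proof -
            \<comment> \<open>The reindexing lemma asks for the value 0 on every box with empty
              interior, the empty one included, where \<open>Sup\<close> and \<open>Inf\<close>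
              carry no information.\<close>
            let ?d = "\<lambda>K. if K = {} then 0 else norm (f (Sup K) - f (Inf K))"
            have ne: "snd z \<noteq> {}" if "z \<in> pN" for z
              using that P(2) pN(1) by (cases z) auto
            have "(\<Sum>(x,K)\<in>pN. ?d K) = (\<Sum>K\<in>snd ` pN. ?d K)"
            proof (rule sum.over_tagged_division_lemma[OF tag])
              fix u v :: real assume "box u v = {}"
              thus "?d (cbox u v) = 0" by (cases "u = v") (auto simp: box_real)
            qed
            moreover have "(\<Sum>K\<in>snd ` pN. norm (f (Sup K) - f (Inf K))) = (\<Sum>K\<in>snd ` pN. ?d K)"
              using ne by (intro sum.cong) auto
            moreover have "(\<Sum>(x,K)\<in>pN. norm (f (Sup K) - f (Inf K))) = (\<Sum>(x,K)\<in>pN. ?d K)"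
              using ne by (intro sum.cong) auto
            ultimately show ?thesis by simp
          qed
          moreover have "norm (\<Sum>z\<in>pN. ?t z) \<le> (\<Sum>(x,K)\<in>pN. norm (f (Sup K) - f (Inf K)))"
            by (rule sum_norm_le) (auto simp: pN_def h_def norm_minus_commute)
          ultimately show ?thesis by linarith
        qed
        ultimately show ?thesis using \<open>a \<le> b\<close> by simp
      qed
      show "\<exists>d. gauge d \<and> (\<forall>p. p tagged_division_of {a..b} \<and> d fine p \<longrightarrow>
          norm ((\<Sum>(x,k)\<in>p. content k *\<^sub>R h x) - (f b - f a)) \<le> e * content {a..b})"
        by (rule exI[of _ \<gamma>], intro conjI allI impI, rule gauge, elim conjE, rule bound)
    qed
  qed
  thus ?thesis
    by (rule has_integral_spike[OF N, rotated]) (auto simp: h_def)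
qed

lemma ac_on_subinterval:
  assumes "ac_on a b f" "t \<le> b"
  shows "ac_on a t f"
  unfolding ac_on_def
proof (intro allI impI)
  fix e :: real assume "e > 0"
  then obtain d where "d > 0" and d: "\<And>\<D> T. \<D> division_of T \<and> T \<subseteq> {a..b} \<and> (\<Sum>K\<in>\<D>. Sup K - Inf K) < d \<Longrightarrow>
        (\<Sum>K\<in>\<D>. norm (f (Sup K) - f (Inf K))) < e"
    using assms(1) unfolding ac_on_def by meson
  have "{a..t} \<subseteq> {a..b}" using assms(2) by auto
  thus "\<exists>d>0. \<forall>\<D> T. \<D> division_of T \<and> T \<subseteq> {a..t} \<and> (\<Sum>K\<in>\<D>. Sup K - Inf K) < d \<longrightarrow>
        (\<Sum>K\<in>\<D>. norm (f (Sup K) - f (Inf K))) < e"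
    using \<open>d > 0\<close> by (intro exI[of _ d] conjI allI impI d) auto
qed

lemma ac_on_deriv_has_integral:
  fixes f :: "real \<Rightarrow> 'a::euclidean_space"
  assumes ac: "ac_on a b f" and N: "negligible N"
    and deriv: "\<And>x. x \<in> {a..b} - N \<Longrightarrow> (f has_vector_derivative g x) (at x within {a..b})"
    and t: "t \<in> {a..b}"
  shows "(g has_integral (f t - f a)) {a..t}"
proof (rule ac_on_has_integral[OF _ ac_on_subinterval[OF ac] N])
  fix x assume "x \<in> {a..t} - N"
  hence "(f has_vector_derivative g x) (at x within {a..b})" using t by (intro deriv) auto
  thus "(f has_vector_derivative g x) (at x within {a..t})"
    by (rule has_vector_derivative_within_subset) (use t in auto)
qed (use t in auto)

section \<open>Indefinite integrals of absolutely integrable functions\<close>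

lemma absolutely_integrable_on_subinterval:
  fixes f :: "real \<Rightarrow> 'a::euclidean_space"
  assumes "f absolutely_integrable_on {a..b}" "a \<le> x" "y \<le> b"
  shows "f absolutely_integrable_on {x..y}"
  using assms by (intro set_integrable_subset[OF assms(1)]) auto

lemma integrable_on_subinterval_abs:
  fixes f :: "real \<Rightarrow> 'a::euclidean_space"
  assumes "f absolutely_integrable_on {a..b}" "a \<le> x" "y \<le> b"
  shows "f integrable_on {x..y}" "(\<lambda>t. norm (f t)) integrable_on {x..y}"
  using absolutely_integrable_on_subinterval[OF assms] absolutely_integrable_on_def by blast+

lemma norm_integral_le_integral_norm:
  fixes f :: "real \<Rightarrow> 'a::euclidean_space"
  assumes "f absolutely_integrable_on {a..b}" "a \<le> x" "y \<le> b"
  shows "norm (integral {x..y} f) \<le> integral {x..y} (\<lambda>t. norm (f t))"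
  using integrable_on_subinterval_abs[OF assms] by (intro integral_norm_bound_integral) auto

lemma abs_integrable_zero: "(\<lambda>_. 0) absolutely_integrable_on {a..b}"
  by (simp add: absolutely_integrable_on_const)

lemma abs_integrable_minus:
  fixes f :: "real \<Rightarrow> 'a::euclidean_space"
  assumes "f absolutely_integrable_on S"
  shows "(\<lambda>t. - f t) absolutely_integrable_on S"
  using absolutely_integrable_linear[OF assms bounded_linear_minus[OF bounded_linear_ident]] by (simp add: o_def)

text \<open>Absolute continuity of the integral, by truncation: cutting \<open>k\<close> off at
  height \<open>n\<close> loses less than \<open>e / 2\<close> of the integral over the whole
  interval, and the truncated part contributes at most \<open>n\<close> times the measure.\<close>

lemma integral_division_small:
  fixes k :: "real \<Rightarrow> real"
  assumes k: "k absolutely_integrable_on {a..b}" and nonneg: "\<And>x. x \<in> {a..b} \<Longrightarrow> 0 \<le> k x" and "e > 0"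
  obtains d where "d > 0"
    "\<And>\<D> T. \<D> division_of T \<Longrightarrow> T \<subseteq> {a..b} \<Longrightarrow> measure lebesgue T < d \<Longrightarrow> integral T k < e"
proof -
  let ?k = "\<lambda>n x. min (k x) (real n)"
  have kn: "?k n absolutely_integrable_on {a..b}" for n
    by (intro absolutely_integrable_min_1 k) (simp add: absolutely_integrable_on_const)
  have k': "k integrable_on {a..b}" "\<And>n. ?k n integrable_on {a..b}"
    using k kn by (auto dest: set_lebesgue_integral_eq_integral(1))
  have "(\<lambda>n. integral {a..b} (?k n)) \<longlonglongrightarrow> integral {a..b} k"
  proof (rule dominated_convergence(2)[where h = k])
    show "(\<lambda>n. ?k n x) \<longlonglongrightarrow> k x" for x
    proof (rule tendsto_eventually)
      obtain N where "k x \<le> real N" using real_arch_simple by blast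
      thus "\<forall>\<^sub>F n in sequentially. ?k n x = k x"
        by (intro eventually_sequentiallyI[of N]) auto
    qed
  qed (use k' nonneg in auto)
  then obtain n where n: "\<bar>integral {a..b} (?k n) - integral {a..b} k\<bar> < e / 2"
    using \<open>e > 0\<close> LIMSEQ_D[of "\<lambda>n. integral {a..b} (?k n)" "integral {a..b} k" "e / 2"] by auto
  \<comment> \<open>Chosen so that \<open>(n + 1) * d = e / 2\<close>; the summand 1 keeps the
    denominator positive when \<open>n = 0\<close>.\<close>
  define d where "d = e / (2 * (real n + 1))"
  show thesis
  proof
    show "d > 0" using \<open>e > 0\<close> by (simp add: d_def)
    fix \<D> T assume D: "\<D> division_of T" and T: "T \<subseteq> {a..b}" and small: "measure lebesgue T < d"
    have TL: "T \<in> lmeasurable" by (rule division_sum_length[OF D])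
    have iT: "k integrable_on T" "?k n integrable_on T"
      using TL T k kn[of n] by (auto intro!: set_lebesgue_integral_eq_integral(1) intro: set_integrable_subset)
    have "integral T k = integral T (\<lambda>x. k x - ?k n x) + integral T (?k n)"
      using iT by (simp add: integral_diff)
    also have "integral T (\<lambda>x. k x - ?k n x) \<le> integral {a..b} (\<lambda>x. k x - ?k n x)"
      using T iT k' by (intro integral_subset_le integrable_diff) auto
    also have "\<dots> = integral {a..b} k - integral {a..b} (?k n)" using k' by (simp add: integral_diff)
    also have "\<dots> < e / 2" using n by linarith
    also have "integral T (?k n) \<le> integral T (\<lambda>_. real n)"
      using iT TL by (intro integral_le) (auto simp: integrable_on_const)
    also have "\<dots> = real n * measure lebesgue T" using TL integral_mult_right[of T "real n" "\<lambda>_. 1"] by (simp add: lmeasure_integral)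
    also have "\<dots> \<le> (real n + 1) * measure lebesgue T" by (intro mult_right_mono) auto
    also have "\<dots> \<le> (real n + 1) * d" using small by (intro mult_left_mono) auto
    also have "\<dots> = e / 2" by (simp add: d_def field_simps)
    finally show "integral T k < e" by simp
  qed
qed

text \<open>A certificate of absolute continuity that is easier to transport than the epsilon-delta
  form: bounds of increments by the integral of a fixed majorant pass to products and to
  exponentials.\<close>

definition dominated_on :: "real \<Rightarrow> real \<Rightarrow> (real \<Rightarrow> real) \<Rightarrow> (real \<Rightarrow> 'a::euclidean_space) \<Rightarrow> bool" where
  "dominated_on a b k f \<longleftrightarrow> k absolutely_integrable_on {a..b} \<and> (\<forall>x\<in>{a..b}. 0 \<le> k x) \<and>
     (\<forall>x y. a \<le> x \<and> x \<le> y \<and> y \<le> b \<longrightarrow> norm (f y - f x) \<le> integral {x..y} k)"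

lemma dominated_on_imp_ac_on:
  assumes "dominated_on a b k f"
  shows "ac_on a b f"
  unfolding ac_on_def
proof (intro allI impI)
  fix e :: real assume "e > 0"
  have k: "k absolutely_integrable_on {a..b}" "\<And>x. x \<in> {a..b} \<Longrightarrow> 0 \<le> k x"
    and dom: "\<And>x y. a \<le> x \<Longrightarrow> x \<le> y \<Longrightarrow> y \<le> b \<Longrightarrow> norm (f y - f x) \<le> integral {x..y} k"
    using assms by (auto simp: dominated_on_def)
  obtain d where d: "d > 0"
    "\<And>\<D> T. \<D> division_of T \<Longrightarrow> T \<subseteq> {a..b} \<Longrightarrow> measure lebesgue T < d \<Longrightarrow> integral T k < e"
    using integral_division_small[OF k \<open>e > 0\<close>] by metis
  have "(\<Sum>K\<in>\<D>. norm (f (Sup K) - f (Inf K))) < e"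
    if D: "\<D> division_of T" and T: "T \<subseteq> {a..b}" and small: "(\<Sum>K\<in>\<D>. Sup K - Inf K) < d" for \<D> T
  proof -
    have "(\<Sum>K\<in>\<D>. norm (f (Sup K) - f (Inf K))) \<le> (\<Sum>K\<in>\<D>. integral K k)"
    proof (rule sum_mono)
      fix K assume K: "K \<in> \<D>"
      obtain u v where uv: "K = {u..v}" using division_ofD(4)[OF D K] by (auto simp: box_real)
      have "u \<le> v" "{u..v} \<subseteq> {a..b}" using division_ofD(2,3)[OF D K] T unfolding uv by (simp, blast)
      thus "norm (f (Sup K) - f (Inf K)) \<le> integral K k" unfolding uv by (auto intro: dom)
    qed
    also have "\<dots> = integral T k"
    proof (rule integral_combine_division_topdown[OF _ D, symmetric])
      show "k integrable_on T"
        using division_sum_length(1)[OF D] T k(1)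
        by (auto intro!: set_lebesgue_integral_eq_integral(1) intro: set_integrable_subset)
    qed
    also have "\<dots> < e" using d(2)[OF D T] small division_sum_length(2)[OF D] by simp
    finally show ?thesis .
  qed
  with d(1) show "\<exists>d>0. \<forall>\<D> T. \<D> division_of T \<and> T \<subseteq> {a..b} \<and> (\<Sum>K\<in>\<D>. Sup K - Inf K) < d \<longrightarrow>
        (\<Sum>K\<in>\<D>. norm (f (Sup K) - f (Inf K))) < e"
    by (intro exI[of _ d] conjI allI impI) auto
qed

lemma dominated_on_integral:
  fixes g :: "real \<Rightarrow> 'a::euclidean_space"
  assumes g: "g absolutely_integrable_on {a..b}"
  shows "dominated_on a b (\<lambda>t. norm (g t)) (\<lambda>t. c + integral {a..t} g)"
  unfolding dominated_on_def
proof (intro conjI ballI allI impI)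
  show "(\<lambda>t. norm (g t)) absolutely_integrable_on {a..b}" using g by (rule set_integrable_norm)
  fix x y assume xy: "a \<le> x \<and> x \<le> y \<and> y \<le> b"
  have "c + integral {a..y} g - (c + integral {a..x} g) = integral {x..y} g"
    using xy integral_interval_diff[OF integrable_on_subinterval_abs(1)[OF g order_refl order_refl], of x y] by simp
  thus "norm (c + integral {a..y} g - (c + integral {a..x} g)) \<le> integral {x..y} (\<lambda>t. norm (g t))"
    using xy norm_integral_le_integral_norm[OF g] by simp
qed auto

lemma dominated_on_bilinear:
  fixes f :: "real \<Rightarrow> 'a::euclidean_space" and g :: "real \<Rightarrow> 'b::euclidean_space"
    and h :: "'a \<Rightarrow> 'b \<Rightarrow> 'c::euclidean_space"
  assumes h: "bounded_bilinear h" and f: "dominated_on a b k f" and g: "dominated_on a b l g"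
    and Bf: "\<And>x. x \<in> {a..b} \<Longrightarrow> norm (f x) \<le> B" and Bg: "\<And>x. x \<in> {a..b} \<Longrightarrow> norm (g x) \<le> B"
    and K: "K \<ge> 0" "\<And>u v. norm (h u v) \<le> norm u * norm v * K"
  shows "dominated_on a b (\<lambda>x. B * K * (k x + l x)) (\<lambda>x. h (f x) (g x))"
  unfolding dominated_on_def
proof (intro conjI ballI allI impI)
  have k: "k absolutely_integrable_on {a..b}" "l absolutely_integrable_on {a..b}"
    using f g by (auto simp: dominated_on_def)
  thus "(\<lambda>x. B * K * (k x + l x)) absolutely_integrable_on {a..b}"
    by (intro set_integrable_mult_right set_integral_add)
  show "0 \<le> B * K * (k x + l x)" if "x \<in> {a..b}" for x
  proof -
    have "B \<ge> 0" using Bf[OF that] norm_ge_zero order_trans by blast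
    thus ?thesis using K(1) f g that by (auto simp: dominated_on_def)
  qed
  fix x y assume xy: "a \<le> x \<and> x \<le> y \<and> y \<le> b"
  have df: "norm (f y - f x) \<le> integral {x..y} k" and dg: "norm (g y - g x) \<le> integral {x..y} l"
    using f g xy by (auto simp: dominated_on_def)
  have B: "B \<ge> 0" using Bf[of x] xy norm_ge_zero order_trans by (metis atLeastAtMost_iff)
  have "h (f y) (g y) - h (f x) (g x) = h (f y - f x) (g y) + h (f x) (g y - g x)"
    by (simp add: bounded_bilinear.diff_left[OF h] bounded_bilinear.diff_right[OF h])
  hence "norm (h (f y) (g y) - h (f x) (g x)) \<le>
      norm (f y - f x) * norm (g y) * K + norm (f x) * norm (g y - g x) * K"
    using K(2) norm_triangle_ineq order_trans add_mono by (smt (verit))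
  also have "\<dots> \<le> integral {x..y} k * B * K + B * integral {x..y} l * K"
    using df dg Bf[of x] Bg[of y] xy K(1) B
    by (intro add_mono mult_right_mono mult_mono) (auto intro: order_trans[OF norm_ge_zero])
  also have "\<dots> = B * K * (integral {x..y} k + integral {x..y} l)"
    by (simp add: algebra_simps)
  also have "\<dots> = integral {x..y} (\<lambda>x. B * K * (k x + l x))"
    using integrable_on_subinterval_abs(1)[OF k(1), of x y] integrable_on_subinterval_abs(1)[OF k(2), of x y] xy
    by (simp add: integral_add)
  finally show "norm (h (f y) (g y) - h (f x) (g x)) \<le> integral {x..y} (\<lambda>x. B * K * (k x + l x))" .
qed

text \<open>The fundamental theorem is applied on \<open>{a..t}\<close>, so derivatives are needed
  relative to that subinterval. One null set serves all \<open>t\<close>, because differentiability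
  within \<open>{a..b}\<close> passes to smaller intervals.\<close>

lemma has_vector_derivative_shift_integral:
  fixes g :: "real \<Rightarrow> 'a::euclidean_space"
  assumes g: "g absolutely_integrable_on {a..b}"
  obtains N where "negligible N"
    "\<And>x t. t \<le> b \<Longrightarrow> x \<in> {a..t} - N \<Longrightarrow> ((\<lambda>t. c + integral {a..t} g) has_vector_derivative g x) (at x within {a..t})"
proof
  let ?N = "{x \<in> {a..b}. \<not> ((\<lambda>t. integral {a..t} g) has_vector_derivative g x) (at x within {a..b})}"
  show "negligible ?N"
    using integrable_on_subinterval_abs(1)[OF g order_refl order_refl] by (rule negligible_not_indefinite_integral_deriv)
  fix x t assume t: "t \<le> b" and x: "x \<in> {a..t} - ?N"
  hence "((\<lambda>t. integral {a..t} g) has_vector_derivative g x) (at x within {a..b})" by auto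
  hence "((\<lambda>t. integral {a..t} g) has_vector_derivative g x) (at x within {a..t})"
    by (rule has_vector_derivative_within_subset) (use t in auto)
  thus "((\<lambda>t. c + integral {a..t} g) has_vector_derivative g x) (at x within {a..t})"
    using has_vector_derivative_add[OF has_vector_derivative_const[of c]] by force
qed

lemma continuous_on_shift_integral:
  fixes g :: "real \<Rightarrow> 'a::euclidean_space"
  assumes g: "g absolutely_integrable_on {a..b}"
  shows "continuous_on {a..b} (\<lambda>t. c + integral {a..t} g)"
  by (intro continuous_intros indefinite_integral_continuous_1 integrable_on_subinterval_abs(1)[OF g]) auto

lemma norm_shift_integral_le:
  fixes g :: "real \<Rightarrow> 'a::euclidean_space"
  assumes g: "g absolutely_integrable_on {a..b}" and t: "t \<in> {a..b}"
  shows "norm (c + integral {a..t} g) \<le> norm c + integral {a..b} (\<lambda>t. norm (g t))"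
proof -
  have "norm (integral {a..t} g) \<le> integral {a..t} (\<lambda>t. norm (g t))"
    using norm_integral_le_integral_norm[OF g, of a t] t by auto
  also have "\<dots> \<le> integral {a..b} (\<lambda>t. norm (g t))"
    using integrable_on_subinterval_abs(2)[OF g] t by (intro integral_subset_le) auto
  finally show ?thesis using norm_triangle_ineq[of c "integral {a..t} g"] by linarith
qed

lemma absolutely_integrable_bilinear_continuous:
  fixes f :: "real \<Rightarrow> 'a::euclidean_space" and g :: "real \<Rightarrow> 'b::euclidean_space"
    and h :: "'a \<Rightarrow> 'b \<Rightarrow> 'c::euclidean_space"
  assumes h: "bounded_bilinear h" and f: "continuous_on {a..b} f" and g: "g absolutely_integrable_on {a..b}"
  shows "(\<lambda>x. h (f x) (g x)) absolutely_integrable_on {a..b}"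
proof (rule absolutely_integrable_bounded_measurable_product[where h = h, OF _ _ _ _ g])
  show "bilinear h" using h by (simp add: bilinear_conv_bounded_bilinear)
  show "f \<in> borel_measurable (lebesgue_on {a..b})"
    using f by (intro continuous_imp_measurable_on_sets_lebesgue) auto
  show "bounded (f ` {a..b})"
    using f by (intro compact_imp_bounded compact_continuous_image) auto
qed auto

text \<open>\<open>F\<close> and \<open>g\<close> are merely integrable, so the product rule holds
  only almost everywhere. It can be integrated because \<open>h (R s) (y s)\<close> is absolutely
  continuous; the boundary term at \<open>a\<close> vanishes since \<open>R a = 0\<close>.\<close>

lemma integral_by_parts_bilinear:
  fixes F :: "real \<Rightarrow> 'a::euclidean_space" and g :: "real \<Rightarrow> 'b::euclidean_space"
    and h :: "'a \<Rightarrow> 'b \<Rightarrow> 'c::euclidean_space" and c :: 'b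
  assumes h: "bounded_bilinear h" and F: "F absolutely_integrable_on {a..b}"
    and g: "g absolutely_integrable_on {a..b}" and t: "t \<in> {a..b}"
  defines "R \<equiv> \<lambda>t. integral {a..t} F" and "y \<equiv> \<lambda>t. c + integral {a..t} g"
  shows "((\<lambda>s. h (F s) (y s) + h (R s) (g s)) has_integral h (R t) (y t)) {a..t}"
proof -
  obtain K where K: "K > 0" "\<And>u v. norm (h u v) \<le> norm u * norm v * K"
    using bounded_bilinear.pos_bounded[OF h] by blast
  define B where "B = max (integral {a..b} (\<lambda>t. norm (F t))) (norm c + integral {a..b} (\<lambda>t. norm (g t)))"
  have R: "dominated_on a b (\<lambda>t. norm (F t)) R" using dominated_on_integral[OF F, of 0] by (simp add: R_def)
  have y: "dominated_on a b (\<lambda>t. norm (g t)) y" unfolding y_def by (rule dominated_on_integral[OF g])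
  have "norm (R x) \<le> B" "norm (y x) \<le> B" if "x \<in> {a..b}" for x
    using norm_shift_integral_le[OF F that, of 0] norm_shift_integral_le[OF g that, of c]
    unfolding B_def R_def y_def by auto
  from dominated_on_bilinear[OF h R y this _ K(2)] K(1)
  have "dominated_on a b (\<lambda>x. B * K * (norm (F x) + norm (g x))) (\<lambda>x. h (R x) (y x))" by simp
  hence ac: "ac_on a t (\<lambda>x. h (R x) (y x))"
    using t by (auto intro: dominated_on_imp_ac_on ac_on_subinterval)
  obtain N1 where N1: "negligible N1" "\<And>x. x \<in> {a..t} - N1 \<Longrightarrow> (R has_vector_derivative F x) (at x within {a..t})"
  proof (rule has_vector_derivative_shift_integral[OF F, of 0])
    fix N assume "negligible N" and N: "\<And>x t. t \<le> b \<Longrightarrow> x \<in> {a..t} - N \<Longrightarrow>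
      ((\<lambda>t. 0 + integral {a..t} F) has_vector_derivative F x) (at x within {a..t})"
    show thesis by (rule that[OF \<open>negligible N\<close>]) (use N t in \<open>simp add: R_def\<close>)
  qed
  obtain N2 where N2: "negligible N2" "\<And>x. x \<in> {a..t} - N2 \<Longrightarrow> (y has_vector_derivative g x) (at x within {a..t})"
  proof (rule has_vector_derivative_shift_integral[OF g, of c])
    fix N assume "negligible N" and N: "\<And>x t. t \<le> b \<Longrightarrow> x \<in> {a..t} - N \<Longrightarrow>
      ((\<lambda>t. c + integral {a..t} g) has_vector_derivative g x) (at x within {a..t})"
    show thesis by (rule that[OF \<open>negligible N\<close>]) (use N t in \<open>simp add: y_def\<close>)
  qed
  have "((\<lambda>s. h (R s) (g s) + h (F s) (y s)) has_integral (h (R t) (y t) - h (R a) (y a))) {a..t}"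
    using t by (intro ac_on_has_integral[OF _ ac negligible_Un[OF N1(1) N2(1)]])
       (auto intro!: bounded_bilinear.has_vector_derivative[OF h] N1 N2)
  moreover have "h (R a) (y a) = 0" by (simp add: R_def bounded_bilinear.zero_left[OF h])
  ultimately show ?thesis by (simp add: add.commute)
qed

section \<open>Gronwall's inequality\<close>

text \<open>The integrand is half the derivative of \<open>exp (2 * m)\<close> almost everywhere,
  and \<open>1 + x \<le> exp x\<close> dominates the increments, which makes
  \<open>exp (2 * m)\<close> absolutely continuous. The gained factor 1/2 closes both Gronwall's
  inequality and the Picard contraction.\<close>

lemma exp_integral_has_integral:
  fixes k :: "real \<Rightarrow> real"
  assumes k: "k absolutely_integrable_on {a..b}" and nonneg: "\<And>x. x \<in> {a..b} \<Longrightarrow> 0 \<le> k x" and t: "t \<in> {a..b}"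
  defines "m \<equiv> \<lambda>t. integral {a..t} k"
  shows "((\<lambda>s. k s * exp (2 * m s)) has_integral (exp (2 * m t) - 1) / 2) {a..t}"
proof -
  have ik: "k integrable_on {a..b}" using k integrable_on_subinterval_abs(1)[OF k] by auto
  have mono: "m x \<le> m y" if "a \<le> x" "x \<le> y" "y \<le> b" for x y
    unfolding m_def using that nonneg integrable_on_subinterval_abs(1)[OF k] by (intro integral_subset_le) auto
  have "dominated_on a b (\<lambda>x. 2 * exp (2 * m b) * k x) (\<lambda>t. exp (2 * m t))"
    unfolding dominated_on_def
  proof (intro conjI ballI allI impI)
    show "(\<lambda>x. 2 * exp (2 * m b) * k x) absolutely_integrable_on {a..b}"
      using k by (intro set_integrable_mult_right) auto
    show "0 \<le> 2 * exp (2 * m b) * k x" if "x \<in> {a..b}" for x using nonneg[OF that] by simp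
    fix x y assume xy: "a \<le> x \<and> x \<le> y \<and> y \<le> b"
    have le: "m x \<le> m y" "m y \<le> m b" using xy by (auto intro: mono)
    have "1 + (2 * m x - 2 * m y) \<le> exp (2 * m x - 2 * m y)" by (rule exp_ge_add_one_self)
    hence "exp (2 * m y) * (1 + (2 * m x - 2 * m y)) \<le> exp (2 * m y) * exp (2 * m x - 2 * m y)"
      by (intro mult_left_mono) auto
    also have "\<dots> = exp (2 * m x)" by (simp add: exp_diff)
    finally have "exp (2 * m y) - exp (2 * m x) \<le> exp (2 * m y) * (2 * (m y - m x))"
      by (simp add: algebra_simps)
    also have "\<dots> \<le> exp (2 * m b) * (2 * (m y - m x))" using le by (intro mult_right_mono) auto
    also have "m y - m x = integral {x..y} k" unfolding m_def using xy integral_interval_diff[OF ik, of x y] by simp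
    also have "exp (2 * m b) * (2 * integral {x..y} k) = integral {x..y} (\<lambda>x. 2 * exp (2 * m b) * k x)" by simp
    finally show "norm (exp (2 * m y) - exp (2 * m x)) \<le> integral {x..y} (\<lambda>x. 2 * exp (2 * m b) * k x)"
      using le by simp
  qed
  hence ac: "ac_on a t (\<lambda>t. exp (2 * m t))"
    using t by (auto intro: dominated_on_imp_ac_on ac_on_subinterval)
  obtain N where N: "negligible N" "\<And>x. x \<in> {a..t} - N \<Longrightarrow> (m has_vector_derivative k x) (at x within {a..t})"
  proof (rule has_vector_derivative_shift_integral[OF k, of 0])
    fix N assume "negligible N" and N: "\<And>x t. t \<le> b \<Longrightarrow> x \<in> {a..t} - N \<Longrightarrow>
      ((\<lambda>t. 0 + integral {a..t} k) has_vector_derivative k x) (at x within {a..t})"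
    show thesis by (rule that[OF \<open>negligible N\<close>]) (use N t in \<open>simp add: m_def\<close>)
  qed
  have "((\<lambda>s. 2 * k s * exp (2 * m s)) has_integral (exp (2 * m t) - exp (2 * m a))) {a..t}"
  proof (rule ac_on_has_integral[OF _ ac N(1)])
    fix x assume x: "x \<in> {a..t} - N"
    have "(m has_real_derivative k x) (at x within {a..t})"
      using N(2)[OF x] by (simp add: has_real_derivative_iff_has_vector_derivative)
    hence "((\<lambda>t. exp (2 * m t)) has_real_derivative 2 * k x * exp (2 * m x)) (at x within {a..t})"
      by (auto intro!: derivative_eq_intros)
    thus "((\<lambda>t. exp (2 * m t)) has_vector_derivative 2 * k x * exp (2 * m x)) (at x within {a..t})"
      by (simp add: has_real_derivative_iff_has_vector_derivative)
  qed (use t in auto)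
  from has_integral_mult_right[OF this, of "1/2"] show ?thesis by (simp add: m_def)
qed

text \<open>The factor 2 comes from comparing \<open>v\<close> with a multiple of \<open>exp (2 * m)\<close>, where \<open>m\<close> is the antiderivative of \<open>k\<close>;
  this needs only a maximum point of the quotient.\<close>
lemma gronwall:
  fixes k v :: "real \<Rightarrow> real"
  assumes k: "k absolutely_integrable_on {a..b}" and nonneg: "\<And>x. x \<in> {a..b} \<Longrightarrow> 0 \<le> k x"
    and v: "continuous_on {a..b} v" and C: "C \<ge> 0"
    and le: "\<And>t. t \<in> {a..b} \<Longrightarrow> v t \<le> C + integral {a..t} (\<lambda>s. k s * v s)"
    and t: "t \<in> {a..b}"
  shows "v t \<le> 2 * C * exp (2 * integral {a..t} k)"
proof -
  define m where "m = (\<lambda>t. integral {a..t} k)"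
  have "continuous_on {a..b} (\<lambda>t. exp (- 2 * m t) * v t)"
    unfolding m_def using v integrable_on_subinterval_abs(1)[OF k]
    by (intro continuous_intros indefinite_integral_continuous_1) auto
  then obtain s where s: "s \<in> {a..b}" and max: "\<And>x. x \<in> {a..b} \<Longrightarrow> exp (- 2 * m x) * v x \<le> exp (- 2 * m s) * v s"
    using continuous_attains_sup[of "{a..b}" "\<lambda>t. exp (- 2 * m t) * v t"] t by auto
  \<comment> \<open>The least multiple of \<open>exp (2 * m)\<close> lying above \<open>v\<close>,
    with equality at \<open>s\<close>. The hypothesis evaluated at \<open>s\<close> then bounds
    \<open>M\<close>, as half of \<open>M * exp (2 * m s)\<close> is absorbed on the left.\<close>
  define M where "M = exp (- 2 * m s) * v s"
  have ex: "v x \<le> M * exp (2 * m x)" if "x \<in> {a..b}" for x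
    using max[OF that] by (simp add: M_def exp_minus field_simps)
  have ms: "m s \<ge> 0" unfolding m_def using s nonneg integrable_on_subinterval_abs(1)[OF k]
    by (intro integral_nonneg) auto
  have kv: "(\<lambda>x. k x * v x) absolutely_integrable_on {a..b}"
    using absolutely_integrable_bilinear_continuous[OF bounded_bilinear_mult v k] by (simp add: mult.commute)
  have "M \<le> 2 * C"
  proof (cases "M \<le> 0")
    case False
    have "v s \<le> C + integral {a..s} (\<lambda>x. k x * v x)" by (rule le[OF s])
    also have "integral {a..s} (\<lambda>x. k x * v x) \<le> M * ((exp (2 * m s) - 1) / 2)"
    proof (rule has_integral_le)
      show "((\<lambda>x. k x * v x) has_integral integral {a..s} (\<lambda>x. k x * v x)) {a..s}"
        using integrable_on_subinterval_abs(1)[OF kv] s by (intro integrable_integral) auto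
      show "((\<lambda>x. M * (k x * exp (2 * m x))) has_integral M * ((exp (2 * m s) - 1) / 2)) {a..s}"
        unfolding m_def by (intro has_integral_mult_right exp_integral_has_integral[OF k nonneg s])
      fix x assume "x \<in> {a..s}"
      hence x: "x \<in> {a..b}" using s by auto
      show "k x * v x \<le> M * (k x * exp (2 * m x))"
        using mult_left_mono[OF ex[OF x] nonneg[OF x]] by (simp add: algebra_simps)
    qed
    also have "\<dots> \<le> M * exp (2 * m s) / 2" using False by (simp add: field_simps)
    finally have "M * exp (2 * m s) \<le> C + M * exp (2 * m s) / 2"
      by (simp add: M_def exp_minus field_simps)
    hence "M * exp (2 * m s) \<le> 2 * C" by simp
    moreover have "M * 1 \<le> M * exp (2 * m s)" using False ms by (intro mult_left_mono) auto
    ultimately show ?thesis by linarith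
  qed (use C in auto)
  hence "M * exp (2 * m t) \<le> 2 * C * exp (2 * m t)" by (intro mult_right_mono) simp_all
  with ex[OF t] show ?thesis unfolding m_def by linarith
qed

section \<open>Linear systems with integrable coefficients\<close>

text \<open>The matrix norm is the Euclidean norm of all entries (Frobenius norm), so Cauchy-Schwarz
  row by row gives the constant 1.\<close>

lemma norm_matrix_vector_mult_le:
  fixes A :: "complex^'n^'m" and x :: "complex^'n"
  shows "norm (A *v x) \<le> norm A * norm x"
proof -
  have "norm ((A *v x) $ i) \<le> norm (A $ i) * norm x" for i
  proof -
    have "norm ((A *v x) $ i) \<le> (\<Sum>j\<in>UNIV. \<bar>norm (A $ i $ j)\<bar> * \<bar>norm (x $ j)\<bar>)"
      unfolding matrix_vector_mult_def by (auto intro!: sum_norm_le simp: norm_mult)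
    also have "\<dots> \<le> norm (A $ i) * norm x"
      unfolding norm_vec_def by (rule L2_set_mult_ineq)
    finally show ?thesis .
  qed
  hence "norm (A *v x) \<le> L2_set (\<lambda>i. norm (A $ i) * norm x) UNIV"
    unfolding norm_vec_def[of "A *v x"] by (intro L2_set_mono) auto
  also have "\<dots> = norm A * norm x"
    by (simp add: L2_set_left_distrib norm_vec_def[of A])
  finally show ?thesis .
qed

lemma bounded_bilinear_matrix_vector_mult:
  "bounded_bilinear ((*v) :: complex^'n^'m \<Rightarrow> complex^'n \<Rightarrow> complex^'m)"
proof (standard, goal_cases)
  case (3 r A x)
  show ?case by (simp add: vec_eq_iff matrix_vector_mult_def scaleR_right.sum)
next
  case (4 A r x)
  show ?case by (simp add: vec_eq_iff matrix_vector_mult_def scaleR_right.sum)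
next
  case 5
  show ?case by (rule exI[of _ 1]) (simp add: norm_matrix_vector_mult_le)
qed (simp_all add: matrix_vector_mult_add_rdistrib matrix_vector_right_distrib)

text \<open>Solutions in the sense of Caratheodory: the integral equation encodes a differential
  equation that holds almost everywhere, without mentioning derivatives. The initial value is left
  free.\<close>

definition system_solution ::
  "real \<Rightarrow> real \<Rightarrow> (real \<Rightarrow> complex^'n^'n) \<Rightarrow> (real \<Rightarrow> complex^'n) \<Rightarrow> (real \<Rightarrow> complex^'n) \<Rightarrow> bool" where
  "system_solution a b A F Y \<longleftrightarrow> continuous_on {a..b} Y \<and>
     (\<forall>t\<in>{a..b}. Y t = Y a + integral {a..t} (\<lambda>s. A s *v Y s + F s))"

lemma system_solutionD:
  assumes "system_solution a b A F Y"
  shows "continuous_on {a..b} Y"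
    "t \<in> {a..b} \<Longrightarrow> Y t = Y a + integral {a..t} (\<lambda>s. A s *v Y s + F s)"
  using assms unfolding system_solution_def by blast+

lemma absolutely_integrable_matrix_vector_mult:
  fixes A :: "real \<Rightarrow> complex^'n^'m"
  assumes "A absolutely_integrable_on {a..b}" "continuous_on {a..b} Y"
  shows "(\<lambda>s. A s *v Y s) absolutely_integrable_on {a..b}"
  using absolutely_integrable_bilinear_continuous[OF
      bounded_bilinear.flip[OF bounded_bilinear_matrix_vector_mult] assms(2,1)] .

text \<open>The common Gronwall step. \<open>C\<close> stands for everything except the term with
  \<open>A\<close> and may be estimated after integration, which admits sources that are small only
  through cancellation.\<close>

lemma norm_bound_of_integral_inequality:
  fixes A :: "real \<Rightarrow> complex^'n^'n"
  assumes A: "A absolutely_integrable_on {a..b}" and D: "continuous_on {a..b} D" and "C \<ge> 0"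
    and K: "integral {a..b} (\<lambda>s. norm (A s)) \<le> K"
    and le: "\<And>t. t \<in> {a..b} \<Longrightarrow> norm (D t) \<le> C + norm (integral {a..t} (\<lambda>s. A s *v D s))"
    and t: "t \<in> {a..b}"
  shows "norm (D t) \<le> 2 * C * exp (2 * K)"
proof -
  note AD = absolutely_integrable_matrix_vector_mult[OF A D]
  have nA: "(\<lambda>s. norm (A s)) absolutely_integrable_on {a..b}" using A by (rule set_integrable_norm)
  have nD: "continuous_on {a..b} (\<lambda>s. norm (D s))" using D by (rule continuous_on_norm)
  have nAD: "(\<lambda>s. norm (A s) * norm (D s)) absolutely_integrable_on {a..b}"
    using absolutely_integrable_bilinear_continuous[OF bounded_bilinear_mult nD nA] by (simp add: mult.commute)
  have "norm (D t) \<le> 2 * C * exp (2 * integral {a..t} (\<lambda>s. norm (A s)))"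
  proof (rule gronwall[OF nA _ nD \<open>C \<ge> 0\<close> _ t])
    fix t assume t: "t \<in> {a..b}"
    have "norm (integral {a..t} (\<lambda>s. A s *v D s)) \<le> integral {a..t} (\<lambda>s. norm (A s) * norm (D s))"
      using t integrable_on_subinterval_abs(1)[OF AD] integrable_on_subinterval_abs(1)[OF nAD]
      by (intro integral_norm_bound_integral norm_matrix_vector_mult_le) auto
    with le[OF t] show "norm (D t) \<le> C + integral {a..t} (\<lambda>s. norm (A s) * norm (D s))" by linarith
  qed auto
  moreover have "integral {a..t} (\<lambda>s. norm (A s)) \<le> integral {a..b} (\<lambda>s. norm (A s))"
    using t integrable_on_subinterval_abs(2)[OF A] by (intro integral_subset_le) auto
  hence "2 * C * exp (2 * integral {a..t} (\<lambda>s. norm (A s))) \<le> 2 * C * exp (2 * K)"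
    using K \<open>C \<ge> 0\<close> by (intro mult_left_mono) auto
  ultimately show ?thesis by linarith
qed

lemma system_solution_bound:
  fixes A :: "real \<Rightarrow> complex^'n^'n"
  assumes A: "A absolutely_integrable_on {a..b}" and F: "F absolutely_integrable_on {a..b}"
    and Y: "system_solution a b A F Y" and K: "integral {a..b} (\<lambda>s. norm (A s)) \<le> K"
    and t: "t \<in> {a..b}"
  shows "norm (Y t) \<le> 2 * exp (2 * K) * (norm (Y a) + integral {a..b} (\<lambda>s. norm (F s)))"
proof -
  let ?N = "integral {a..b} (\<lambda>s. norm (F s))"
  have cont: "continuous_on {a..b} Y" by (rule system_solutionD(1)[OF Y])
  note AY = absolutely_integrable_matrix_vector_mult[OF A cont]
  have N: "?N \<ge> 0" using integrable_on_subinterval_abs(2)[OF F] by (intro integral_nonneg) auto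
  have "norm (Y t) \<le> 2 * (norm (Y a) + ?N) * exp (2 * K)"
  proof (rule norm_bound_of_integral_inequality[OF A cont _ K _ t])
    show "0 \<le> norm (Y a) + ?N" using N by simp
    fix t assume t: "t \<in> {a..b}"
    have "Y t = Y a + integral {a..t} (\<lambda>s. A s *v Y s + F s)" by (rule system_solutionD(2)[OF Y t])
    also have "integral {a..t} (\<lambda>s. A s *v Y s + F s) = integral {a..t} (\<lambda>s. A s *v Y s) + integral {a..t} F"
      using t integrable_on_subinterval_abs(1)[OF AY] integrable_on_subinterval_abs(1)[OF F]
      by (intro integral_add) auto
    finally have "Y t = (Y a + integral {a..t} F) + integral {a..t} (\<lambda>s. A s *v Y s)" by simp
    hence "norm (Y t) \<le> norm (Y a + integral {a..t} F) + norm (integral {a..t} (\<lambda>s. A s *v Y s))"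
      by (simp only: norm_triangle_ineq)
    with norm_shift_integral_le[OF F t, of "Y a"]
    show "norm (Y t) \<le> norm (Y a) + ?N + norm (integral {a..t} (\<lambda>s. A s *v Y s))" by linarith
  qed
  thus ?thesis by (simp add: algebra_simps)
qed

text \<open>Real coefficients suffice: the map from initial values to boundary forms is later
  treated as linear over the reals.\<close>

lemma system_solution_lincomb:
  fixes A :: "real \<Rightarrow> complex^'n^'n"
  assumes A: "A absolutely_integrable_on {a..b}" and F: "F absolutely_integrable_on {a..b}"
    and G: "G absolutely_integrable_on {a..b}"
    and Y: "system_solution a b A F Y" and Z: "system_solution a b A G Z"
  shows "system_solution a b A (\<lambda>t. x *\<^sub>R F t + y *\<^sub>R G t) (\<lambda>t. x *\<^sub>R Y t + y *\<^sub>R Z t)"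
  unfolding system_solution_def
proof (intro conjI ballI)
  have cY: "continuous_on {a..b} Y" and cZ: "continuous_on {a..b} Z"
    by (rule system_solutionD(1)[OF Y], rule system_solutionD(1)[OF Z])
  thus "continuous_on {a..b} (\<lambda>t. x *\<^sub>R Y t + y *\<^sub>R Z t)" by (intro continuous_intros)
  fix t assume t: "t \<in> {a..b}"
  interpret mv: bounded_bilinear "(*v) :: complex^'n^'n \<Rightarrow> complex^'n \<Rightarrow> complex^'n"
    by (rule bounded_bilinear_matrix_vector_mult)
  have int: "(\<lambda>s. A s *v Y s + F s) integrable_on {a..t}" "(\<lambda>s. A s *v Z s + G s) integrable_on {a..t}"
    using t by (auto intro!: integrable_on_subinterval_abs(1)[of a b] set_integral_add(1)
        absolutely_integrable_matrix_vector_mult A F G cY cZ)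
  have "integral {a..t} (\<lambda>s. A s *v (x *\<^sub>R Y s + y *\<^sub>R Z s) + (x *\<^sub>R F s + y *\<^sub>R G s))
      = integral {a..t} (\<lambda>s. x *\<^sub>R (A s *v Y s + F s) + y *\<^sub>R (A s *v Z s + G s))"
    by (simp add: mv.add_right mv.scaleR_right scaleR_add_right algebra_simps)
  also have "\<dots> = x *\<^sub>R integral {a..t} (\<lambda>s. A s *v Y s + F s) + y *\<^sub>R integral {a..t} (\<lambda>s. A s *v Z s + G s)"
    using int by (subst integral_add) (auto intro: integrable_cmul)
  finally have eq: "integral {a..t} (\<lambda>s. A s *v (x *\<^sub>R Y s + y *\<^sub>R Z s) + (x *\<^sub>R F s + y *\<^sub>R G s)) = \<dots>" .
  have "Y t = Y a + integral {a..t} (\<lambda>s. A s *v Y s + F s)" "Z t = Z a + integral {a..t} (\<lambda>s. A s *v Z s + G s)"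
    by (rule system_solutionD(2)[OF Y t], rule system_solutionD(2)[OF Z t])
  hence "x *\<^sub>R Y t + y *\<^sub>R Z t = x *\<^sub>R (Y a + integral {a..t} (\<lambda>s. A s *v Y s + F s)) +
      y *\<^sub>R (Z a + integral {a..t} (\<lambda>s. A s *v Z s + G s))" by (simp only:)
  thus "x *\<^sub>R Y t + y *\<^sub>R Z t = x *\<^sub>R Y a + y *\<^sub>R Z a +
      integral {a..t} (\<lambda>s. A s *v (x *\<^sub>R Y s + y *\<^sub>R Z s) + (x *\<^sub>R F s + y *\<^sub>R G s))"
    unfolding eq by (simp only: scaleR_add_right add_ac)
qed

lemma system_solution_diff:
  fixes A :: "real \<Rightarrow> complex^'n^'n"
  assumes "A absolutely_integrable_on {a..b}" "F absolutely_integrable_on {a..b}"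
    and "system_solution a b A F Y" "system_solution a b A F Z"
  shows "system_solution a b A (\<lambda>_. 0) (\<lambda>t. Y t - Z t)"
  using system_solution_lincomb[OF assms(1,2,2,3,4), of 1 "-1"] by simp

lemma system_solution_unique:
  fixes A :: "real \<Rightarrow> complex^'n^'n"
  assumes A: "A absolutely_integrable_on {a..b}" and F: "F absolutely_integrable_on {a..b}"
    and "system_solution a b A F Y" "system_solution a b A F Z" "Y a = Z a" "t \<in> {a..b}"
  shows "Y t = Z t"
  using system_solution_bound[OF A _ system_solution_diff[OF assms(1-4)] order_refl assms(6)] assms(5)
  by (simp add: absolutely_integrable_on_const)

text \<open>Picard iteration contracts in the norm weighted by \<open>exp (- 2 * m t)\<close>, where \<open>m\<close> is the
  antiderivative of the norm of the coefficient matrix.\<close>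
lemma system_solution_exists:
  fixes A :: "real \<Rightarrow> complex^'n^'n"
  assumes "a \<le> b" and A: "A absolutely_integrable_on {a..b}" and F: "F absolutely_integrable_on {a..b}"
  obtains Y where "system_solution a b A F Y" "Y a = c"
proof -
  define k where "k = (\<lambda>s. norm (A s))"
  have k: "k absolutely_integrable_on {a..b}" "\<And>x. 0 \<le> k x"
    using A unfolding k_def by (auto intro: set_integrable_norm)
  define m where "m = (\<lambda>t. integral {a..t} k)"
  have cm: "continuous_on {a..b} m"
    unfolding m_def using integrable_on_subinterval_abs(1)[OF k(1)] by (intro indefinite_integral_continuous_1) auto
  \<comment> \<open>The unknown is \<open>X = exp (- 2 * m) * Y\<close>, so the weighted norm of
    \<open>Y\<close> becomes the plain supremum norm of \<open>X\<close>.\<close>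
  define H where "H = (\<lambda>X t. exp (- 2 * m t) *\<^sub>R (c + integral {a..t} (\<lambda>s. A s *v (exp (2 * m s) *\<^sub>R X s) + F s)))"
  have cX: "continuous_on {a..b} (\<lambda>s. exp (2 * m s) *\<^sub>R apply_bcontfun X s)"
    for X :: "real \<Rightarrow>\<^sub>C (complex^'n)"
    using cm by (intro continuous_intros) auto
  have abs: "(\<lambda>s. A s *v (exp (2 * m s) *\<^sub>R apply_bcontfun X s) + F s) absolutely_integrable_on {a..b}"
    for X :: "real \<Rightarrow>\<^sub>C (complex^'n)"
    by (intro set_integral_add(1) absolutely_integrable_matrix_vector_mult A F cX)
  have cH: "continuous_on (cbox a b) (H X)" for X :: "real \<Rightarrow>\<^sub>C (complex^'n)"
    unfolding H_def box_real by (intro continuous_intros cm continuous_on_shift_integral abs)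
  \<comment> \<open>Completeness is that of the bounded continuous functions on the whole line;
    clamping the argument extends an iterate constantly beyond the interval.\<close>
  have "\<exists>g :: real \<Rightarrow>\<^sub>C (complex^'n). \<forall>x. g x = H X (clamp a b x)" for X :: "real \<Rightarrow>\<^sub>C (complex^'n)"
    by (rule continuous_on_cbox_bcontfunE[OF cH[of X]]) blast
  then obtain T :: "(real \<Rightarrow>\<^sub>C (complex^'n)) \<Rightarrow> (real \<Rightarrow>\<^sub>C (complex^'n))"
    where T: "\<And>X x. T X x = H X (clamp a b x)" by metis
  have "dist (T X) (T X') \<le> 1/2 * dist X X'" for X X'
  proof (rule dist_bound)
    fix x :: real
    define t where "t = clamp a b x"
    have t: "t \<in> {a..b}" using clamp_in_interval[of a b x] \<open>a \<le> b\<close> by (simp add: t_def)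
    let ?f = "\<lambda>X s. A s *v (exp (2 * m s) *\<^sub>R apply_bcontfun X s) + F s"
    have i: "?f X integrable_on {a..t}" "?f X' integrable_on {a..t}"
      using integrable_on_subinterval_abs(1)[OF abs] t by auto
    have "norm (integral {a..t} (?f X) - integral {a..t} (?f X')) = norm (integral {a..t} (\<lambda>s. ?f X s - ?f X' s))"
      using integral_diff[OF i] by (simp only:)
    \<comment> \<open>Undoing the weight costs \<open>exp (2 * m s)\<close> under the integral, but
      against \<open>k s\<close> this integrates to less than \<open>exp (2 * m t) / 2\<close>: the
      contraction factor is 1/2.\<close>
    also have "\<dots> \<le> dist X X' * ((exp (2 * m t) - 1) / 2)"
    proof -
      have h: "((\<lambda>s. dist X X' * (k s * exp (2 * m s))) has_integral dist X X' * ((exp (2 * m t) - 1) / 2)) {a..t}"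
        unfolding m_def using k t by (intro has_integral_mult_right exp_integral_has_integral) auto
      have "norm (integral {a..t} (\<lambda>s. ?f X s - ?f X' s)) \<le> integral {a..t} (\<lambda>s. dist X X' * (k s * exp (2 * m s)))"
      proof (rule integral_norm_bound_integral)
        fix s assume "s \<in> {a..t}"
        have "?f X s - ?f X' s = A s *v (exp (2 * m s) *\<^sub>R (X s - X' s))"
          by (simp add: matrix_vector_mult_diff_distrib scaleR_diff_right)
        hence "norm (?f X s - ?f X' s) \<le> k s * (exp (2 * m s) * norm (X s - X' s))"
          using norm_matrix_vector_mult_le[of "A s" "exp (2 * m s) *\<^sub>R (X s - X' s)"] by (simp add: k_def)
        also have "\<dots> \<le> k s * (exp (2 * m s) * dist X X')"
          using k(2) dist_bounded[of X s X'] by (intro mult_left_mono) (auto simp: dist_norm)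
        finally show "norm (?f X s - ?f X' s) \<le> dist X X' * (k s * exp (2 * m s))" by (simp add: mult_ac)
      qed (use integrable_diff[OF i] h in \<open>auto dest: has_integral_integrable\<close>)
      thus ?thesis unfolding integral_unique[OF h] .
    qed
    also have "\<dots> \<le> dist X X' * (exp (2 * m t) / 2)" by (intro mult_left_mono) auto
    finally have "exp (- 2 * m t) * norm (integral {a..t} (?f X) - integral {a..t} (?f X'))
        \<le> exp (- 2 * m t) * (dist X X' * (exp (2 * m t) / 2))" by (intro mult_left_mono) auto
    also have "\<dots> = 1/2 * dist X X'" by (simp add: exp_minus)
    finally show "dist (T X x) (T X' x) \<le> 1/2 * dist X X'"
      by (simp add: T t_def[symmetric] H_def dist_norm scaleR_diff_right[symmetric])
  qed
  hence "\<forall>X X'. dist (T X) (T X') \<le> 1/2 * dist X X'" by blast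
  hence "\<exists>!X. T X = X" by (rule banach_fix_type[rotated 2]) simp_all
  then obtain X where X: "T X = X" by (elim ex1E)
  define Y where "Y = (\<lambda>s. exp (2 * m s) *\<^sub>R apply_bcontfun X s)"
  have Yt: "Y t = c + integral {a..t} (\<lambda>s. A s *v Y s + F s)" if "t \<in> {a..b}" for t
  proof -
    have "X t = H X t" using T[of X t] that by (simp add: X clamp_cancel_cbox[of t a b])
    thus ?thesis unfolding Y_def H_def by (simp add: exp_minus)
  qed
  have "Y a = c" using Yt[of a] \<open>a \<le> b\<close> by simp
  moreover have "system_solution a b A F Y"
    unfolding system_solution_def \<open>Y a = c\<close> using Yt cX[of X] unfolding Y_def by blast
  ultimately show thesis by (rule that[rotated])
qed

section \<open>Boundary value problems for linear systems\<close>

text \<open>Integration by parts moves the weak convergence of the coefficients onto the fixed solution \<open>Y0\<close>.\<close>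
lemma system_solution_perturbation:
  fixes A A0 :: "real \<Rightarrow> complex^'n^'n"
  assumes A: "A absolutely_integrable_on {a..b}" and A0: "A0 absolutely_integrable_on {a..b}"
    and F: "F absolutely_integrable_on {a..b}"
    and Y: "system_solution a b A F Y" and Y0: "system_solution a b A0 F Y0" and init: "Y a = Y0 a"
    and K: "integral {a..b} (\<lambda>s. norm (A s)) \<le> K" and K0: "integral {a..b} (\<lambda>s. norm (A0 s)) \<le> K"
    and r: "\<And>t. t \<in> {a..b} \<Longrightarrow> norm (integral {a..t} (\<lambda>s. A s - A0 s)) \<le> r"
    and t: "t \<in> {a..b}"
  shows "norm (Y t - Y0 t) \<le> r * (2 * exp (2 * K) * (2 * exp (2 * K) * (1 + K) + 1)) *
           (norm (Y0 a) + integral {a..b} (\<lambda>s. norm (F s)))"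
proof -
  interpret mv: bounded_bilinear "(*v) :: complex^'n^'n \<Rightarrow> complex^'n \<Rightarrow> complex^'n"
    by (rule bounded_bilinear_matrix_vector_mult)
  define N where "N = integral {a..b} (\<lambda>s. norm (F s))"
  \<comment> \<open>The a priori bound for \<open>Y0\<close>. With \<open>K\<close> it also bounds
    the L1 norm of \<open>g\<close>, the derivative of \<open>Y0\<close>, which is what integration
    by parts needs.\<close>
  define B where "B = 2 * exp (2 * K) * (norm (Y0 a) + N)"
  define E where "E = (\<lambda>s. A s - A0 s)"
  define R where "R = (\<lambda>t. integral {a..t} E)"
  define g where "g = (\<lambda>s. A0 s *v Y0 s + F s)"
  have ab: "a \<in> {a..b}" using t by auto
  have r0: "r \<ge> 0" using r[OF t] norm_ge_zero order_trans by blast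
  have N0: "N \<ge> 0" unfolding N_def using integrable_on_subinterval_abs(2)[OF F] by (intro integral_nonneg) auto
  have K_nonneg: "K \<ge> 0"
    using K integral_nonneg[OF integrable_on_subinterval_abs(2)[OF A order_refl order_refl]] by fastforce
  have B0: "B \<ge> 0" using N0 by (simp add: B_def)
  have c: "continuous_on {a..b} Y" "continuous_on {a..b} Y0"
    by (rule system_solutionD(1)[OF Y], rule system_solutionD(1)[OF Y0])
  have E: "E absolutely_integrable_on {a..b}" unfolding E_def by (intro set_integral_diff A A0)
  have AY: "(\<lambda>s. A s *v Y s) absolutely_integrable_on {a..b}"
    "(\<lambda>s. A s *v (Y s - Y0 s)) absolutely_integrable_on {a..b}"
    "(\<lambda>s. E s *v Y0 s) absolutely_integrable_on {a..b}"
    by (intro absolutely_integrable_matrix_vector_mult A E c continuous_on_diff)+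
  have AY0: "(\<lambda>s. A0 s *v Y0 s) absolutely_integrable_on {a..b}"
    by (intro absolutely_integrable_matrix_vector_mult A0 c)
  have g: "g absolutely_integrable_on {a..b}" unfolding g_def by (intro set_integral_add AY0 F)
  have bd: "norm (Y0 x) \<le> B" if "x \<in> {a..b}" for x
    using system_solution_bound[OF A0 F Y0 K0 that] by (simp add: B_def N_def)
  have Y0t: "Y0 x = Y0 a + integral {a..x} g" if "x \<in> {a..b}" for x
    unfolding g_def by (rule system_solutionD(2)[OF Y0 that])
  have intg: "integral {a..b} (\<lambda>s. norm (g s)) \<le> K * B + N"
  proof -
    have "integral {a..b} (\<lambda>s. norm (g s)) \<le> integral {a..b} (\<lambda>s. norm (A0 s) * B + norm (F s))"
    proof (rule integral_le)
      fix s assume s: "s \<in> {a..b}"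
      have "norm (g s) \<le> norm (A0 s *v Y0 s) + norm (F s)" unfolding g_def by (rule norm_triangle_ineq)
      also have "norm (A0 s *v Y0 s) \<le> norm (A0 s) * norm (Y0 s)" by (rule norm_matrix_vector_mult_le)
      also have "\<dots> \<le> norm (A0 s) * B" by (intro mult_left_mono bd s) auto
      finally show "norm (g s) \<le> norm (A0 s) * B + norm (F s)" by simp
    qed (use integrable_on_subinterval_abs(2)[OF g] integrable_on_subinterval_abs(2)[OF A0]
          integrable_on_subinterval_abs(2)[OF F] in \<open>auto intro!: integrable_add integrable_on_mult_left\<close>)
    also have "\<dots> = integral {a..b} (\<lambda>s. norm (A0 s)) * B + N"
      using integrable_on_subinterval_abs(2)[OF A0] integrable_on_subinterval_abs(2)[OF F]
      by (subst integral_add) (auto simp: N_def intro!: integrable_on_mult_left)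
    also have "\<dots> \<le> K * B + N" using K0 B0 by (auto intro: mult_right_mono)
    finally show ?thesis .
  qed
  \<comment> \<open>By parts, the integral of \<open>E *v Y0\<close> equals
    \<open>R x *v Y0 x\<close> minus the integral of \<open>R *v g\<close>. Bounding
    \<open>R\<close> by \<open>r\<close> yields \<open>r * B\<close> and
    \<open>r * (K * B + N)\<close>.\<close>
  define C where "C = r * (B + K * B + N)"
  have weak: "norm (integral {a..x} (\<lambda>s. E s *v Y0 s)) \<le> C" if x: "x \<in> {a..b}" for x
  proof -
    have cR: "continuous_on {a..b} R" unfolding R_def
      using continuous_on_shift_integral[OF E, of 0] by simp
    have Rg: "(\<lambda>s. R s *v g s) absolutely_integrable_on {a..b}"
      by (rule absolutely_integrable_bilinear_continuous[OF bounded_bilinear_matrix_vector_mult cR g])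
    have i: "(\<lambda>s. E s *v Y0 s) integrable_on {a..x}" "(\<lambda>s. R s *v g s) integrable_on {a..x}"
      using x integrable_on_subinterval_abs(1)[OF AY(3)] integrable_on_subinterval_abs(1)[OF Rg] by auto
    have "integral {a..x} (\<lambda>s. E s *v (Y0 a + integral {a..s} g) + R s *v g s)
        = R x *v (Y0 a + integral {a..x} g)"
      unfolding R_def
      by (rule integral_unique[OF integral_by_parts_bilinear[OF bounded_bilinear_matrix_vector_mult E g x]])
    also have "integral {a..x} (\<lambda>s. E s *v (Y0 a + integral {a..s} g) + R s *v g s)
        = integral {a..x} (\<lambda>s. E s *v Y0 s + R s *v g s)"
    proof (rule integral_cong)
      fix s assume "s \<in> {a..x}"
      hence s: "s \<in> {a..b}" using x by auto
      show "E s *v (Y0 a + integral {a..s} g) + R s *v g s = E s *v Y0 s + R s *v g s"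
        by (simp only: Y0t[OF s, symmetric])
    qed
    also have "\<dots> = integral {a..x} (\<lambda>s. E s *v Y0 s) + integral {a..x} (\<lambda>s. R s *v g s)"
      using i by (rule integral_add)
    finally have eq: "integral {a..x} (\<lambda>s. E s *v Y0 s) = R x *v Y0 x - integral {a..x} (\<lambda>s. R s *v g s)"
      unfolding Y0t[OF x, symmetric] by (simp add: eq_diff_eq)
    have Rr: "norm (R s) \<le> r" if "s \<in> {a..b}" for s using r[OF that] by (simp add: R_def E_def)
    have "norm (R x *v Y0 x) \<le> norm (R x) * norm (Y0 x)" by (rule norm_matrix_vector_mult_le)
    also have "\<dots> \<le> r * B" using Rr[OF x] bd[OF x] r0 by (intro mult_mono) auto
    finally have 1: "norm (R x *v Y0 x) \<le> r * B" .
    have "norm (integral {a..x} (\<lambda>s. R s *v g s)) \<le> integral {a..x} (\<lambda>s. r * norm (g s))"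
    proof (rule integral_norm_bound_integral[OF i(2)])
      show "(\<lambda>s. r * norm (g s)) integrable_on {a..x}"
        using x integrable_on_subinterval_abs(2)[OF g] by (intro integrable_on_mult_right) auto
      fix s assume "s \<in> {a..x}"
      hence "norm (R s) \<le> r" using x by (intro Rr) auto
      hence "norm (R s) * norm (g s) \<le> r * norm (g s)" by (intro mult_right_mono) auto
      with norm_matrix_vector_mult_le[of "R s" "g s"] show "norm (R s *v g s) \<le> r * norm (g s)" by linarith
    qed
    also have "\<dots> = r * integral {a..x} (\<lambda>s. norm (g s))" by simp
    also have "\<dots> \<le> r * integral {a..b} (\<lambda>s. norm (g s))"
      using x r0 integrable_on_subinterval_abs(2)[OF g] by (intro mult_left_mono integral_subset_le) auto
    also have "\<dots> \<le> r * (K * B + N)" using intg r0 by (intro mult_left_mono) auto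
    finally have 2: "norm (integral {a..x} (\<lambda>s. R s *v g s)) \<le> r * (K * B + N)" .
    have "norm (integral {a..x} (\<lambda>s. E s *v Y0 s)) \<le> r * B + r * (K * B + N)"
      unfolding eq using norm_triangle_ineq4[of "R x *v Y0 x" "integral {a..x} (\<lambda>s. R s *v g s)"] 1 2 by linarith
    thus ?thesis by (simp add: C_def algebra_simps)
  qed
  have C0: "C \<ge> 0" using r0 B0 N0 K_nonneg by (simp add: C_def)
  have "norm (Y t - Y0 t) \<le> 2 * C * exp (2 * K)"
  proof (rule norm_bound_of_integral_inequality[OF A _ C0 K _ t])
    show "continuous_on {a..b} (\<lambda>t. Y t - Y0 t)" by (intro continuous_on_diff c)
    fix x assume x: "x \<in> {a..b}"
    have i: "(\<lambda>s. A s *v Y s) integrable_on {a..x}" "(\<lambda>s. A0 s *v Y0 s) integrable_on {a..x}"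
      "(\<lambda>s. A s *v (Y s - Y0 s)) integrable_on {a..x}" "(\<lambda>s. E s *v Y0 s) integrable_on {a..x}" "F integrable_on {a..x}"
      using x integrable_on_subinterval_abs(1)[OF AY(1)] integrable_on_subinterval_abs(1)[OF AY0]
        integrable_on_subinterval_abs(1)[OF AY(2)] integrable_on_subinterval_abs(1)[OF AY(3)]
        integrable_on_subinterval_abs(1)[OF F] by auto
    have "Y x - Y0 x = integral {a..x} (\<lambda>s. A s *v Y s + F s) - integral {a..x} (\<lambda>s. A0 s *v Y0 s + F s)"
      unfolding system_solutionD(2)[OF Y x] system_solutionD(2)[OF Y0 x] init by simp
    also have "\<dots> = integral {a..x} (\<lambda>s. A s *v Y s) - integral {a..x} (\<lambda>s. A0 s *v Y0 s)"
      using i by (simp add: integral_add)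
    also have "\<dots> = integral {a..x} (\<lambda>s. A s *v Y s - A0 s *v Y0 s)" using i by (simp add: integral_diff)
    \<comment> \<open>\<open>A\<close> acts on the unknown difference, where its L1 bound
      \<open>K\<close> is enough, while \<open>A - A0\<close> meets only the limit solution
      \<open>Y0\<close>.\<close>
    also have "(\<lambda>s. A s *v Y s - A0 s *v Y0 s) = (\<lambda>s. A s *v (Y s - Y0 s) + E s *v Y0 s)"
      by (simp add: E_def mv.diff_left mv.diff_right)
    also have "integral {a..x} \<dots> = integral {a..x} (\<lambda>s. A s *v (Y s - Y0 s)) + integral {a..x} (\<lambda>s. E s *v Y0 s)"
      using i by (intro integral_add)
    finally show "norm (Y x - Y0 x) \<le> C + norm (integral {a..x} (\<lambda>s. A s *v (Y s - Y0 s)))"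
      using weak[OF x] norm_triangle_ineq[of "integral {a..x} (\<lambda>s. A s *v (Y s - Y0 s))" "integral {a..x} (\<lambda>s. E s *v Y0 s)"]
      by simp
  qed
  also have "\<dots> = r * (2 * exp (2 * K)) * (2 * exp (2 * K) * (1 + K) * (norm (Y0 a) + N) + N)"
    by (simp add: C_def B_def algebra_simps)
  \<comment> \<open>The isolated \<open>N\<close> is enlarged so that the size of the data can be
    pulled out as a single factor.\<close>
  also have "\<dots> \<le> r * (2 * exp (2 * K)) * (2 * exp (2 * K) * (1 + K) * (norm (Y0 a) + N) + (norm (Y0 a) + N))"
    using r0 by (intro mult_left_mono add_left_mono) auto
  also have "\<dots> = r * (2 * exp (2 * K) * (2 * exp (2 * K) * (1 + K) + 1)) * (norm (Y0 a) + N)"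
    by (simp add: algebra_simps)
  finally show ?thesis by (simp add: N_def)
qed

section \<open>Boundary forms and unique solvability\<close>

definition boundary_form :: "real \<Rightarrow> real \<Rightarrow> complex^'n^'n \<Rightarrow> complex^'n^'n \<Rightarrow> (real \<Rightarrow> complex^'n) \<Rightarrow> complex^'n" where
  "boundary_form a b P Q Y = P *v Y a + Q *v Y b"

text \<open>By uniqueness for initial values, \<open>Y a = 0\<close> means that \<open>Y\<close>
  vanishes on the whole interval; the initial value serves as the finite-dimensional coordinate of a
  homogeneous solution.\<close>

definition only_trivial_solution ::
  "real \<Rightarrow> real \<Rightarrow> (real \<Rightarrow> complex^'n^'n) \<Rightarrow> complex^'n^'n \<Rightarrow> complex^'n^'n \<Rightarrow> bool" where
  "only_trivial_solution a b A P Q \<longleftrightarrow>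
     (\<forall>Y. system_solution a b A (\<lambda>_. 0) Y \<and> boundary_form a b P Q Y = 0 \<longrightarrow> Y a = 0)"

lemma boundary_form_diff:
  "boundary_form a b P Q (\<lambda>t. Y t - Z t) = boundary_form a b P Q Y - boundary_form a b P Q Z"
  by (simp add: boundary_form_def matrix_vector_mult_diff_distrib)

lemma norm_boundary_form_le:
  assumes "norm (Y a) \<le> B" "norm (Y b) \<le> B"
  shows "norm (boundary_form a b P Q Y) \<le> (norm P + norm Q) * B"
proof -
  have "norm (P *v Y a) \<le> norm P * B" "norm (Q *v Y b) \<le> norm Q * B"
    using norm_matrix_vector_mult_le[of P "Y a"] norm_matrix_vector_mult_le[of Q "Y b"] assms
      mult_left_mono[of _ _ "norm P"] mult_left_mono[of _ _ "norm Q"] norm_ge_zero by (meson order_trans)+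
  thus ?thesis unfolding boundary_form_def using norm_triangle_ineq[of "P *v Y a" "Q *v Y b"] by (simp add: algebra_simps)
qed

text \<open>The Fredholm alternative in finite dimensions: the boundary form of a homogeneous
  solution depends linearly on the initial value, and an injective linear map of a
  finite-dimensional space to itself is both bounded below and surjective.\<close>

lemma boundary_problem_bounded_below:
  fixes A :: "real \<Rightarrow> complex^'n^'n"
  assumes "a \<le> b" and A: "A absolutely_integrable_on {a..b}"
    and inj: "only_trivial_solution a b A P Q"
  obtains m where "m > 0"
    "\<And>Y. system_solution a b A (\<lambda>_. 0) Y \<Longrightarrow> m * norm (Y a) \<le> norm (boundary_form a b P Q Y)"
    "\<And>c. \<exists>Y. system_solution a b A (\<lambda>_. 0) Y \<and> boundary_form a b P Q Y = c"
proof -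
  interpret mv: bounded_bilinear "(*v) :: complex^'n^'n \<Rightarrow> complex^'n \<Rightarrow> complex^'n"
    by (rule bounded_bilinear_matrix_vector_mult)
  have "\<exists>Y. system_solution a b A (\<lambda>_. 0) Y \<and> Y a = c" for c
    using system_solution_exists[OF \<open>a \<le> b\<close> A abs_integrable_zero] by metis
  \<comment> \<open>The chosen solutions are arbitrary outside \<open>{a..b}\<close>. Linearity is
    therefore claimed only at \<open>b\<close>, where it follows from uniqueness; at
    \<open>a\<close> it is immediate.\<close>
  then obtain \<Phi> where \<Phi>: "\<And>c. system_solution a b A (\<lambda>_. 0) (\<Phi> c)" "\<And>c. \<Phi> c a = c" by metis
  define M where "M = (\<lambda>c. boundary_form a b P Q (\<Phi> c))"
  have \<Phi>_lin: "\<Phi> (x *\<^sub>R c + y *\<^sub>R d) b = x *\<^sub>R \<Phi> c b + y *\<^sub>R \<Phi> d b" for x y c d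
  proof (rule system_solution_unique[OF A abs_integrable_zero])
    show "system_solution a b A (\<lambda>_. 0) (\<Phi> (x *\<^sub>R c + y *\<^sub>R d))" by (rule \<Phi>)
    show "system_solution a b A (\<lambda>_. 0) (\<lambda>t. x *\<^sub>R \<Phi> c t + y *\<^sub>R \<Phi> d t)"
      using system_solution_lincomb[OF A abs_integrable_zero abs_integrable_zero \<Phi>(1)[of c] \<Phi>(1)[of d], of x y] by simp
  qed (use \<open>a \<le> b\<close> \<Phi>(2) in auto)
  have M_lin: "M (x *\<^sub>R c + y *\<^sub>R d) = x *\<^sub>R M c + y *\<^sub>R M d" for x y c d
    unfolding M_def boundary_form_def \<Phi>_lin \<Phi>(2) by (simp add: mv.add_right mv.scaleR_right scaleR_add_right)
  have lin: "linear M"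
    using M_lin[of 1 _ 1] M_lin[of _ _ 0] by (intro linearI) simp_all
  have "d = 0" if "M d = 0" for d
    using inj[unfolded only_trivial_solution_def, rule_format, of "\<Phi> d"] \<Phi> that by (simp add: M_def)
  hence "inj M" unfolding linear_injective_0[OF lin] by simp
  then obtain m where m: "m > 0" "\<And>c. m * norm c \<le> norm (M c)"
    using linear_inj_bounded_below_pos[OF lin] by metis
  have "surj M" by (rule linear_injective_imp_surjective[OF lin \<open>inj M\<close>]) (rule refl)
  show thesis
  proof
    show "m > 0" by fact
    fix Y assume Y: "system_solution a b A (\<lambda>_. 0) Y"
    have "Y b = \<Phi> (Y a) b"
      by (rule system_solution_unique[OF A abs_integrable_zero Y \<Phi>(1)]) (use \<open>a \<le> b\<close> \<Phi>(2) in auto)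
    hence "boundary_form a b P Q Y = M (Y a)" by (simp add: M_def boundary_form_def \<Phi>(2))
    thus "m * norm (Y a) \<le> norm (boundary_form a b P Q Y)" using m(2) by simp
  next
    fix c
    obtain d where "M d = c" using \<open>surj M\<close> by (metis surjD)
    thus "\<exists>Y. system_solution a b A (\<lambda>_. 0) Y \<and> boundary_form a b P Q Y = c"
      using \<Phi>(1) unfolding M_def by blast
  qed
qed

text \<open>Any solution for \<open>F\<close> can be corrected by a homogeneous one with the same
  boundary form, which exists by surjectivity.\<close>

lemma boundary_problem_solvable:
  fixes A :: "real \<Rightarrow> complex^'n^'n"
  assumes "a \<le> b" and A: "A absolutely_integrable_on {a..b}"
    and inj: "only_trivial_solution a b A P Q"
    and F: "F absolutely_integrable_on {a..b}"
  obtains Y where "system_solution a b A F Y" "boundary_form a b P Q Y = 0"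
proof -
  obtain Z where Z: "system_solution a b A F Z" using system_solution_exists[OF \<open>a \<le> b\<close> A F] by metis
  obtain V where V: "system_solution a b A (\<lambda>_. 0) V" "boundary_form a b P Q V = boundary_form a b P Q Z"
    using boundary_problem_bounded_below[OF assms(1-3)] by metis
  have "system_solution a b A F (\<lambda>t. Z t - V t)"
    using system_solution_lincomb[OF A F abs_integrable_zero Z V(1), of 1 "-1"] by simp
  moreover have "boundary_form a b P Q (\<lambda>t. Z t - V t) = 0" using V(2) by (simp add: boundary_form_diff)
  ultimately show thesis using that by blast
qed

text \<open>A bound for Green's operator. The solution \<open>Z\<close> starting from 0 carries the
  source, so \<open>Y - Z\<close> is homogeneous with initial value \<open>Y a\<close>, and its
  boundary form is opposite to that of \<open>Z\<close>. The lower bound \<open>m\<close> turns this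
  into a bound on \<open>Y a\<close>.\<close>

lemma boundary_problem_bound:
  fixes A :: "real \<Rightarrow> complex^'n^'n"
  assumes "a \<le> b" and A: "A absolutely_integrable_on {a..b}"
    and inj: "only_trivial_solution a b A P Q"
  obtains C where "C \<ge> 0"
    "\<And>F Y t. F absolutely_integrable_on {a..b} \<Longrightarrow> system_solution a b A F Y \<Longrightarrow>
       boundary_form a b P Q Y = 0 \<Longrightarrow> t \<in> {a..b} \<Longrightarrow> norm (Y t) \<le> C * integral {a..b} (\<lambda>s. norm (F s))"
proof -
  obtain m where m: "m > 0"
    "\<And>Y. system_solution a b A (\<lambda>_. 0) Y \<Longrightarrow> m * norm (Y a) \<le> norm (boundary_form a b P Q Y)"
    using boundary_problem_bounded_below[OF assms] by metis
  define e where "e = 2 * exp (2 * integral {a..b} (\<lambda>s. norm (A s)))"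
  define p where "p = (norm P + norm Q) * e / m"
  have e: "e \<ge> 0" and p: "p \<ge> 0" using m(1) by (auto simp: e_def p_def)
  show thesis
  proof
    show "0 \<le> e * (p + 1)" using e p by simp
    fix F Y t assume F: "F absolutely_integrable_on {a..b}" and Y: "system_solution a b A F Y"
      "boundary_form a b P Q Y = 0" and t: "t \<in> {a..b}"
    define N where "N = integral {a..b} (\<lambda>s. norm (F s))"
    obtain Z where Z: "system_solution a b A F Z" "Z a = 0" using system_solution_exists[OF \<open>a \<le> b\<close> A F] by metis
    have Zb: "norm (Z x) \<le> e * N" if "x \<in> {a..b}" for x
      using system_solution_bound[OF A F Z(1) order_refl that] Z(2) by (simp add: e_def N_def)
    have V: "system_solution a b A (\<lambda>_. 0) (\<lambda>t. Y t - Z t)" by (rule system_solution_diff[OF A F Y(1) Z(1)])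
    have "m * norm (Y a) \<le> norm (boundary_form a b P Q (\<lambda>t. Y t - Z t))"
      using m(2)[OF V] Z(2) by simp
    also have "\<dots> = norm (boundary_form a b P Q Z)" by (simp add: boundary_form_diff Y(2))
    also have "\<dots> \<le> (norm P + norm Q) * (e * N)"
      using \<open>a \<le> b\<close> by (intro norm_boundary_form_le Zb) auto
    finally have "norm (Y a) \<le> p * N" using m(1) by (simp add: p_def field_simps)
    hence "e * (norm (Y a) + N) \<le> e * (p * N + N)" using e by (intro mult_left_mono) auto
    moreover have "norm (Y t) \<le> e * (norm (Y a) + N)"
      unfolding e_def N_def by (rule system_solution_bound[OF A F Y(1) order_refl t])
    ultimately have "norm (Y t) \<le> e * (p * N + N)" by linarith
    thus "norm (Y t) \<le> e * (p + 1) * integral {a..b} (\<lambda>s. norm (F s))" by (simp add: N_def algebra_simps)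
  qed
qed

section \<open>Stability under perturbation of coefficients and boundary matrices\<close>

text \<open>Relative to the size of the data, the terms account for the change of \<open>P\<close>
  at \<open>a\<close>, the change of \<open>Q\<close> at \<open>b\<close> (where the solution is at
  most \<open>2 * exp (2 * K)\<close> times the data), and the distance from \<open>Y b\<close> to
  \<open>Y0 b\<close>. For fixed \<open>K\<close> the sum vanishes in the limit.\<close>

definition boundary_defect :: "real \<Rightarrow> real \<Rightarrow> complex^'n^'n \<Rightarrow> complex^'n^'n \<Rightarrow> complex^'n^'n \<Rightarrow> complex^'n^'n \<Rightarrow> real" where
  "boundary_defect K r P0 Q0 P Q = norm (P - P0) + norm (Q - Q0) * (2 * exp (2 * K)) +
     norm Q0 * (r * (2 * exp (2 * K) * (2 * exp (2 * K) * (1 + K) + 1)))"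

lemma boundary_form_perturbation:
  fixes A A0 :: "real \<Rightarrow> complex^'n^'n"
  assumes "a \<le> b"
    and A: "A absolutely_integrable_on {a..b}" and A0: "A0 absolutely_integrable_on {a..b}"
    and F: "F absolutely_integrable_on {a..b}"
    and Y: "system_solution a b A F Y" and Y0: "system_solution a b A0 F Y0" and init: "Y a = Y0 a"
    and K: "integral {a..b} (\<lambda>s. norm (A s)) \<le> K" and K0: "integral {a..b} (\<lambda>s. norm (A0 s)) \<le> K"
    and r: "\<And>t. t \<in> {a..b} \<Longrightarrow> norm (integral {a..t} (\<lambda>s. A s - A0 s)) \<le> r"
  shows "norm (boundary_form a b P Q Y - boundary_form a b P0 Q0 Y0) \<le>
           boundary_defect K r P0 Q0 P Q * (norm (Y0 a) + integral {a..b} (\<lambda>s. norm (F s)))"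
proof -
  interpret mv: bounded_bilinear "(*v) :: complex^'n^'n \<Rightarrow> complex^'n \<Rightarrow> complex^'n"
    by (rule bounded_bilinear_matrix_vector_mult)
  define N where "N = norm (Y0 a) + integral {a..b} (\<lambda>s. norm (F s))"
  define e where "e = 2 * exp (2 * K)"
  define M where "M = r * (e * (e * (1 + K) + 1))"
  have "norm (Y0 a) \<le> N"
    unfolding N_def using integral_nonneg[OF integrable_on_subinterval_abs(2)[OF F order_refl order_refl]] by simp
  hence 1: "norm ((P - P0) *v Y0 a) \<le> norm (P - P0) * N"
    using norm_matrix_vector_mult_le[of "P - P0" "Y0 a"] mult_left_mono[of "norm (Y0 a)" N "norm (P - P0)"] by simp
  have "norm (Y b) \<le> e * N"
    using system_solution_bound[OF A F Y K, of b] \<open>a \<le> b\<close> init by (simp add: N_def e_def)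
  hence 2: "norm ((Q - Q0) *v Y b) \<le> norm (Q - Q0) * (e * N)"
    using norm_matrix_vector_mult_le[of "Q - Q0" "Y b"] mult_left_mono[of "norm (Y b)" "e * N" "norm (Q - Q0)"] by simp
  have "norm (Y b - Y0 b) \<le> M * N"
    unfolding M_def e_def N_def using \<open>a \<le> b\<close>
    by (intro system_solution_perturbation[OF A A0 F Y Y0 init K K0 r]) auto
  hence 3: "norm (Q0 *v (Y b - Y0 b)) \<le> norm Q0 * (M * N)"
    using norm_matrix_vector_mult_le[of "Q0" "Y b - Y0 b"] mult_left_mono[of "norm (Y b - Y0 b)" "M * N" "norm Q0"] by simp
  have "boundary_form a b P Q Y - boundary_form a b P0 Q0 Y0 =
      (P - P0) *v Y0 a + (Q - Q0) *v Y b + Q0 *v (Y b - Y0 b)"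
    unfolding boundary_form_def init by (simp add: mv.diff_left mv.diff_right)
  also have "norm \<dots> \<le> norm (P - P0) * N + norm (Q - Q0) * (e * N) + norm Q0 * (M * N)"
    using 1 2 3 norm_triangle_ineq[of "(P - P0) *v Y0 a + (Q - Q0) *v Y b" "Q0 *v (Y b - Y0 b)"]
      norm_triangle_ineq[of "(P - P0) *v Y0 a" "(Q - Q0) *v Y b"] by linarith
  also have "\<dots> = boundary_defect K r P0 Q0 P Q * N"
    unfolding boundary_defect_def e_def[symmetric] M_def[symmetric] by (simp add: distrib_right mult.assoc)
  finally show ?thesis unfolding N_def .
qed

text \<open>A defect of at most \<open>m / 2\<close> leaves the lower bound \<open>m / 2\<close> for
  the perturbed boundary form, hence uniqueness. To compare solutions, the perturbed solution
  \<open>Z\<close> with the initial value of \<open>Y0\<close> is interposed: \<open>Z - Y0\<close>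
  compares two initial value problems, and \<open>Y - Z\<close> is homogeneous with a boundary form
  opposite to that of \<open>Z\<close>, which is small because that of \<open>Y0\<close>
  vanishes.\<close>

lemma boundary_problem_perturbation:
  fixes A A0 :: "real \<Rightarrow> complex^'n^'n"
  assumes "a \<le> b"
    and A: "A absolutely_integrable_on {a..b}" and A0: "A0 absolutely_integrable_on {a..b}"
    and K: "integral {a..b} (\<lambda>s. norm (A s)) \<le> K" and K0: "integral {a..b} (\<lambda>s. norm (A0 s)) \<le> K"
    and r: "\<And>t. t \<in> {a..b} \<Longrightarrow> norm (integral {a..t} (\<lambda>s. A s - A0 s)) \<le> r"
    and m: "m > 0" "\<And>Y. system_solution a b A0 (\<lambda>_. 0) Y \<Longrightarrow> m * norm (Y a) \<le> norm (boundary_form a b P0 Q0 Y)"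
    and small: "boundary_defect K r P0 Q0 P Q \<le> m / 2"
  shows "only_trivial_solution a b A P Q"
    and "\<lbrakk>F absolutely_integrable_on {a..b}; system_solution a b A F Y; boundary_form a b P Q Y = 0;
      system_solution a b A0 F Y0; boundary_form a b P0 Q0 Y0 = 0;
      norm (Y0 a) \<le> C * integral {a..b} (\<lambda>s. norm (F s)); t \<in> {a..b}\<rbrakk> \<Longrightarrow>
      norm (Y t - Y0 t) \<le> (r * (2 * exp (2 * K) * (2 * exp (2 * K) * (1 + K) + 1)) +
         2 * exp (2 * K) * (2 / m * boundary_defect K r P0 Q0 P Q)) * (C + 1) * integral {a..b} (\<lambda>s. norm (F s))"
proof -
  let ?\<delta> = "boundary_defect K r P0 Q0 P Q"
  have low: "m / 2 * norm (Y a) \<le> norm (boundary_form a b P Q Y)" if Y: "system_solution a b A (\<lambda>_. 0) Y" for Y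
  proof -
    obtain Z where Z: "system_solution a b A0 (\<lambda>_. 0) Z" "Z a = Y a"
      using system_solution_exists[OF \<open>a \<le> b\<close> A0 abs_integrable_zero] by metis
    have "norm (boundary_form a b P Q Y - boundary_form a b P0 Q0 Z) \<le> ?\<delta> * norm (Y a)"
      using boundary_form_perturbation[OF \<open>a \<le> b\<close> A A0 abs_integrable_zero Y Z(1) Z(2)[symmetric] K K0 r, of P Q P0 Q0] Z(2) by simp
    also have "\<dots> \<le> m / 2 * norm (Y a)" using small by (intro mult_right_mono) auto
    finally have "norm (boundary_form a b P0 Q0 Z) \<le> norm (boundary_form a b P Q Y) + m / 2 * norm (Y a)"
      using norm_triangle_sub[of "boundary_form a b P0 Q0 Z" "boundary_form a b P Q Y"]
      by (simp add: norm_minus_commute)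
    thus ?thesis using m(2)[OF Z(1)] Z(2) by (simp add: field_simps)
  qed
  show "only_trivial_solution a b A P Q"
    unfolding only_trivial_solution_def
  proof (intro allI impI)
    fix Y assume Y: "system_solution a b A (\<lambda>_. 0) Y \<and> boundary_form a b P Q Y = 0"
    from Y have "m / 2 * norm (Y a) \<le> 0" using low[of Y] by simp
    thus "Y a = 0" using m(1) by (simp add: mult_le_0_iff)
  qed
  assume F: "F absolutely_integrable_on {a..b}" and Y: "system_solution a b A F Y" "boundary_form a b P Q Y = 0"
    and Y0: "system_solution a b A0 F Y0" "boundary_form a b P0 Q0 Y0 = 0"
    and C: "norm (Y0 a) \<le> C * integral {a..b} (\<lambda>s. norm (F s))" and t: "t \<in> {a..b}"
  define N where "N = integral {a..b} (\<lambda>s. norm (F s))"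
  define e where "e = 2 * exp (2 * K)"
  define M where "M = r * (e * (e * (1 + K) + 1))"
  \<comment> \<open>\<open>C\<close> bounds the initial value of \<open>Y0\<close> by the source, so
    the size of all data reduces to a multiple of \<open>N\<close>.\<close>
  have N: "norm (Y0 a) + N \<le> (C + 1) * N" using C by (simp add: N_def algebra_simps)
  obtain Z where Z: "system_solution a b A F Z" "Z a = Y0 a"
    using system_solution_exists[OF \<open>a \<le> b\<close> A F] by metis
  have K_nonneg: "K \<ge> 0"
    using K integral_nonneg[OF integrable_on_subinterval_abs(2)[OF A order_refl order_refl]] by fastforce
  have r0: "r \<ge> 0" using r[OF t] norm_ge_zero order_trans by blast
  have \<delta>: "?\<delta> \<ge> 0" unfolding boundary_defect_def using K_nonneg r0 by simp
  have "e \<ge> 0" "M \<ge> 0" using K_nonneg r0 by (auto simp: e_def M_def)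
  have "norm (Z t - Y0 t) \<le> M * (norm (Y0 a) + N)"
    unfolding M_def e_def N_def by (rule system_solution_perturbation[OF A A0 F Z(1) Y0(1) Z(2) K K0 r t])
  also have "\<dots> \<le> M * ((C + 1) * N)" by (rule mult_left_mono[OF N \<open>M \<ge> 0\<close>])
  finally have 1: "norm (Z t - Y0 t) \<le> M * ((C + 1) * N)" .
  have "norm (boundary_form a b P Q Z) \<le> ?\<delta> * (norm (Y0 a) + N)"
    using boundary_form_perturbation[OF \<open>a \<le> b\<close> A A0 F Z(1) Y0(1) Z(2) K K0 r, of P Q P0 Q0] Y0(2)
    by (simp add: N_def)
  also have "\<dots> \<le> ?\<delta> * ((C + 1) * N)" by (rule mult_left_mono[OF N \<delta>])
  finally have bZ: "norm (boundary_form a b P Q Z) \<le> ?\<delta> * ((C + 1) * N)" .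
  have V: "system_solution a b A (\<lambda>_. 0) (\<lambda>t. Y t - Z t)" by (rule system_solution_diff[OF A F Y(1) Z(1)])
  have "m / 2 * norm (Y a - Z a) \<le> ?\<delta> * ((C + 1) * N)"
    using low[OF V] bZ by (simp add: boundary_form_diff Y(2))
  hence "norm (Y a - Z a) \<le> 2 / m * ?\<delta> * ((C + 1) * N)" using m(1) by (simp add: field_simps)
  hence "e * norm (Y a - Z a) \<le> e * (2 / m * ?\<delta> * ((C + 1) * N))" by (rule mult_left_mono[OF _ \<open>e \<ge> 0\<close>])
  moreover have "norm (Y t - Z t) \<le> e * norm (Y a - Z a)"
    using system_solution_bound[OF A abs_integrable_zero V K t] by (simp add: e_def)
  ultimately have "norm (Y t - Z t) \<le> e * (2 / m * ?\<delta> * ((C + 1) * N))" by linarith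
  with 1 norm_triangle_ineq[of "Y t - Z t" "Z t - Y0 t"]
  have "norm (Y t - Y0 t) \<le> M * ((C + 1) * N) + e * (2 / m * ?\<delta> * ((C + 1) * N))" by simp
  also have "\<dots> = (M + e * (2 / m * ?\<delta>)) * (C + 1) * N" by (simp only: distrib_right mult.assoc)
  finally show "norm (Y t - Y0 t) \<le> (r * (2 * exp (2 * K) * (2 * exp (2 * K) * (1 + K) + 1)) +
         2 * exp (2 * K) * (2 / m * boundary_defect K r P0 Q0 P Q)) * (C + 1) * integral {a..b} (\<lambda>s. norm (F s))"
    unfolding M_def e_def N_def .
qed

text \<open>The rate \<open>c\<close> depends neither on the source nor on the solutions, so
  convergence is uniform over sources of bounded L1 norm. This is the form that yields operator
  norms.\<close>

theorem boundary_problem_convergence: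
  fixes A :: "'i \<Rightarrow> real \<Rightarrow> complex^'n^'n" and P Q :: "'i \<Rightarrow> complex^'n^'n" and \<F> :: "'i filter"
  assumes "a \<le> b"
    and A0: "A0 absolutely_integrable_on {a..b}" and inj: "only_trivial_solution a b A0 P0 Q0"
    and A: "\<forall>\<^sub>F i in \<F>. A i absolutely_integrable_on {a..b}"
    and K: "\<forall>\<^sub>F i in \<F>. integral {a..b} (\<lambda>s. norm (A i s)) \<le> K"
    and r: "(r \<longlongrightarrow> 0) \<F>" "\<forall>\<^sub>F i in \<F>. \<forall>t\<in>{a..b}. norm (integral {a..t} (\<lambda>s. A i s - A0 s)) \<le> r i"
    and P: "(P \<longlongrightarrow> P0) \<F>" and Q: "(Q \<longlongrightarrow> Q0) \<F>"
  obtains c where "(c \<longlongrightarrow> 0) \<F>"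
    "\<forall>\<^sub>F i in \<F>. only_trivial_solution a b (A i) (P i) (Q i)"
    "\<forall>\<^sub>F i in \<F>. \<forall>F Y Y0. F absolutely_integrable_on {a..b} \<longrightarrow>
       system_solution a b (A i) F Y \<longrightarrow> boundary_form a b (P i) (Q i) Y = 0 \<longrightarrow>
       system_solution a b A0 F Y0 \<longrightarrow> boundary_form a b P0 Q0 Y0 = 0 \<longrightarrow>
       (\<forall>t\<in>{a..b}. norm (Y t - Y0 t) \<le> c i * integral {a..b} (\<lambda>s. norm (F s)))"
proof -
  \<comment> \<open>\<open>K\<close> bounds the approximating matrices, while the estimates ask for
    one bound that also covers \<open>A0\<close>.\<close>
  define K' where "K' = max K (integral {a..b} (\<lambda>s. norm (A0 s)))"
  obtain m where m: "m > 0"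
    "\<And>Y. system_solution a b A0 (\<lambda>_. 0) Y \<Longrightarrow> m * norm (Y a) \<le> norm (boundary_form a b P0 Q0 Y)"
    using boundary_problem_bounded_below[OF \<open>a \<le> b\<close> A0 inj] by metis
  obtain C where C:
    "\<And>F Y t. F absolutely_integrable_on {a..b} \<Longrightarrow> system_solution a b A0 F Y \<Longrightarrow>
       boundary_form a b P0 Q0 Y = 0 \<Longrightarrow> t \<in> {a..b} \<Longrightarrow> norm (Y t) \<le> C * integral {a..b} (\<lambda>s. norm (F s))"
    using boundary_problem_bound[OF \<open>a \<le> b\<close> A0 inj] by metis
  define \<delta> where "\<delta> = (\<lambda>i. boundary_defect K' (r i) P0 Q0 (P i) (Q i))"
  define c where "c = (\<lambda>i. (r i * (2 * exp (2 * K') * (2 * exp (2 * K') * (1 + K') + 1)) +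
         2 * exp (2 * K') * (2 / m * \<delta> i)) * (C + 1))"
  have \<delta>: "(\<delta> \<longlongrightarrow> 0) \<F>"
    unfolding \<delta>_def boundary_defect_def using P Q r(1) by (auto intro!: tendsto_eq_intros)
  hence c: "(c \<longlongrightarrow> 0) \<F>"
    unfolding c_def using r(1) m(1) by (auto intro!: tendsto_eq_intros)
  have ev: "\<forall>\<^sub>F i in \<F>. A i absolutely_integrable_on {a..b} \<and> integral {a..b} (\<lambda>s. norm (A i s)) \<le> K \<and>
      (\<forall>t\<in>{a..b}. norm (integral {a..t} (\<lambda>s. A i s - A0 s)) \<le> r i) \<and> \<delta> i < m / 2"
    using A K r(2) order_tendstoD(2)[OF \<delta>, of "m / 2"] m(1)
    by (intro eventually_conj) auto
  note pert = boundary_problem_perturbation[OF \<open>a \<le> b\<close> _ A0 _ _ _ m, where K = K']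
  show thesis
  proof (rule that[OF c])
    show "\<forall>\<^sub>F i in \<F>. only_trivial_solution a b (A i) (P i) (Q i)"
      using ev
    proof eventually_elim
      case (elim i)
      show ?case by (rule pert(1)[where r = "r i"]) (use elim in \<open>auto simp: K'_def \<delta>_def\<close>)
    qed
    show "\<forall>\<^sub>F i in \<F>. \<forall>F Y Y0. F absolutely_integrable_on {a..b} \<longrightarrow>
       system_solution a b (A i) F Y \<longrightarrow> boundary_form a b (P i) (Q i) Y = 0 \<longrightarrow>
       system_solution a b A0 F Y0 \<longrightarrow> boundary_form a b P0 Q0 Y0 = 0 \<longrightarrow>
       (\<forall>t\<in>{a..b}. norm (Y t - Y0 t) \<le> c i * integral {a..b} (\<lambda>s. norm (F s)))"
      using ev
    proof eventually_elim
      case (elim i)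
      show ?case
      proof (intro allI impI ballI)
        fix F Y Y0 t
        assume "F absolutely_integrable_on {a..b}" "system_solution a b (A i) F Y"
          "boundary_form a b (P i) (Q i) Y = 0" "system_solution a b A0 F Y0"
          "boundary_form a b P0 Q0 Y0 = 0" "t \<in> {a..b}"
        moreover from this have "norm (Y0 a) \<le> C * integral {a..b} (\<lambda>s. norm (F s))"
          using \<open>a \<le> b\<close> by (intro C) auto
        ultimately show "norm (Y t - Y0 t) \<le> c i * integral {a..b} (\<lambda>s. norm (F s))"
          unfolding c_def \<delta>_def
          by (intro pert(2)[where r = "r i"]) (use elim in \<open>auto simp: K'_def \<delta>_def\<close>)
      qed
    qed
  qed
qed

section \<open>Square-integrable functions\<close>

lemma AE_lebesgue_on_iff:
  assumes "S \<in> sets lebesgue"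
  shows "(AE x in lebesgue_on S. P x) \<longleftrightarrow> (\<exists>N. negligible N \<and> (\<forall>x\<in>S - N. P x))"
proof -
  have "(AE x in lebesgue_on S. P x) \<longleftrightarrow> (AE x in lebesgue. x \<in> S \<longrightarrow> P x)"
    using assms by (intro AE_restrict_space_iff) auto
  also have "\<dots> \<longleftrightarrow> (\<exists>N. negligible N \<and> (\<forall>x\<in>S - N. P x))"
    unfolding eventually_ae_filter negligible_iff_null_sets Bex_def
    by (intro arg_cong[where f = Ex] ext) auto
  finally show ?thesis .
qed

lemma bounded_linear_axis: "bounded_linear (axis k :: 'a::real_normed_vector \<Rightarrow> 'a^'n)"
proof (rule bounded_linear_intro[where K = 1])
  show "norm (axis k x :: 'a^'n) \<le> norm x * 1" for x
  proof -
    have "norm (axis k x :: 'a^'n) \<le> (\<Sum>i\<in>UNIV. norm ((axis k x :: 'a^'n) $ i))"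
      unfolding norm_vec_def by (intro L2_set_le_sum) auto
    also have "\<dots> = (\<Sum>i\<in>UNIV. if i = k then norm x else 0)"
      by (intro sum.cong) (auto simp: axis_def)
    finally show ?thesis by simp
  qed
qed (simp_all add: vec_eq_iff axis_def)

lemma vector_2_eq: "(vector [x, y] :: 'a::real_normed_vector^2) = axis 1 x + axis 2 y"
  by (simp add: vec_eq_iff forall_2 axis_def)

lemma norm_vec_2_le: "norm (v :: 'a::real_normed_vector^2) \<le> norm (v $ 1) + norm (v $ 2)"
  using L2_set_le_sum[of UNIV "\<lambda>i. norm (v $ i)"] unfolding norm_vec_def sum_2 by simp

lemma has_integral_vector_2:
  fixes f g :: "real \<Rightarrow> 'a::euclidean_space"
  assumes "(f has_integral x) S" "(g has_integral y) S"
  shows "((\<lambda>t. vector [f t, g t] :: 'a^2) has_integral vector [x, y]) S"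
  unfolding vector_2_eq
  using has_integral_add[OF has_integral_linear[OF assms(1) bounded_linear_axis[of 1]]
      has_integral_linear[OF assms(2) bounded_linear_axis[of 2]]]
  by (simp add: o_def)

lemma absolutely_integrable_vector_2:
  fixes f g :: "real \<Rightarrow> 'a::euclidean_space"
  assumes "f absolutely_integrable_on S" "g absolutely_integrable_on S"
  shows "(\<lambda>t. vector [f t, g t] :: 'a^2) absolutely_integrable_on S"
  unfolding vector_2_eq
  using set_integral_add(1)[OF absolutely_integrable_linear[OF assms(1) bounded_linear_axis[of 1]]
      absolutely_integrable_linear[OF assms(2) bounded_linear_axis[of 2]]]
  by (simp add: o_def)

lemma integral_vec_nth:
  fixes f :: "real \<Rightarrow> ('a::euclidean_space)^'n"
  assumes "f integrable_on S"
  shows "integral S f $ i = integral S (\<lambda>x. f x $ i)"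
  using integral_linear[OF assms bounded_linear_vec_nth[of i]] by (simp add: o_def)

lemma integrable_lebesgue_on_iff:
  fixes f :: "real \<Rightarrow> 'a::euclidean_space"
  shows "integrable (lebesgue_on {a..b}) f \<longleftrightarrow> f absolutely_integrable_on {a..b}"
  unfolding set_integrable_def by (rule integrable_restrict_space) auto

text \<open>A potential and its complex square both enter the coefficient matrix. On a bounded
  interval the first is integrable by \<open>2 * u \<le> 1 + u\<^sup>2\<close>.\<close>

lemma L2_on_abs_integrable:
  assumes f: "f \<in> L2_on a b"
  shows "f absolutely_integrable_on {a..b}" "(\<lambda>x. (f x)\<^sup>2) absolutely_integrable_on {a..b}"
    "(\<lambda>x. (norm (f x))\<^sup>2) absolutely_integrable_on {a..b}"
proof -
  have m: "f \<in> borel_measurable (lebesgue_on {a..b})"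
    and i: "integrable (lebesgue_on {a..b}) (\<lambda>x. (norm (f x))\<^sup>2)"
    using f by (auto simp: L2_on_def)
  show "(\<lambda>x. (norm (f x))\<^sup>2) absolutely_integrable_on {a..b}"
    using i by (simp add: integrable_lebesgue_on_iff)
  have "integrable (lebesgue_on {a..b}) (\<lambda>x. (f x)\<^sup>2)"
    using m by (intro Bochner_Integration.integrable_bound[OF i]) (auto simp: norm_power)
  thus "(\<lambda>x. (f x)\<^sup>2) absolutely_integrable_on {a..b}" by (simp add: integrable_lebesgue_on_iff)
  have "integrable (lebesgue_on {a..b}) (\<lambda>x. 1 + (norm (f x))\<^sup>2)"
    using i by (intro Bochner_Integration.integrable_add)
      (auto simp: integrable_lebesgue_on_iff absolutely_integrable_on_const)
  moreover have "norm (f x) \<le> norm (1 + (norm (f x))\<^sup>2)" for x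
  proof -
    have "0 \<le> (norm (f x) - 1)\<^sup>2" by simp
    also have "\<dots> = (norm (f x))\<^sup>2 - 2 * norm (f x) + 1" by (simp add: power2_eq_square algebra_simps)
    finally have "2 * norm (f x) \<le> 1 + (norm (f x))\<^sup>2" by simp
    moreover have "norm (f x) \<ge> 0" by simp
    ultimately show ?thesis unfolding real_norm_def by linarith
  qed
  ultimately have "integrable (lebesgue_on {a..b}) f"
    by (intro Bochner_Integration.integrable_bound[OF _ m, of "\<lambda>x. 1 + (norm (f x))\<^sup>2"] always_eventually allI)
  thus "f absolutely_integrable_on {a..b}" by (simp add: integrable_lebesgue_on_iff)
qed

lemma L2_norm_on_eq:
  assumes f: "f \<in> L2_on a b"
  shows "L2_norm_on a b f = sqrt (integral {a..b} (\<lambda>x. (norm (f x))\<^sup>2))"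
  unfolding L2_norm_on_def using L2_on_abs_integrable(3)[OF f]
  by (simp add: lebesgue_integral_eq_integral integrable_lebesgue_on_iff)

lemma L2_norm_on_square:
  assumes f: "f \<in> L2_on a b"
  shows "(L2_norm_on a b f)\<^sup>2 = integral {a..b} (\<lambda>x. (norm (f x))\<^sup>2)"
  unfolding L2_norm_on_eq[OF f]
  using integrable_on_subinterval_abs(1)[OF L2_on_abs_integrable(3)[OF f]] by (simp add: integral_nonneg)

text \<open>Cauchy-Schwarz with a cruder constant, by integrating
  \<open>2 * s * u \<le> s\<^sup>2 + u\<^sup>2\<close> with a free parameter \<open>s\<close>: it is
  set to \<open>N\<close> if \<open>N > 0\<close> and sent to 0 if \<open>N = 0\<close>.\<close>

lemma integral_norm_le_L2_norm:
  assumes "a \<le> b" and f: "f \<in> L2_on a b"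
  shows "integral {a..b} (\<lambda>x. norm (f x)) \<le> (b - a + 1) * L2_norm_on a b f"
proof -
  define N where "N = L2_norm_on a b f"
  have N: "N \<ge> 0" unfolding N_def L2_norm_on_def by (simp add: integral_nonneg_AE)
  note i = integrable_on_subinterval_abs(1)[OF L2_on_abs_integrable(3)[OF f] order_refl order_refl]
    integrable_on_subinterval_abs(2)[OF L2_on_abs_integrable(1)[OF f] order_refl order_refl]
  have key: "integral {a..b} (\<lambda>x. norm (f x)) \<le> s / 2 * (b - a) + N\<^sup>2 / (2 * s)" if "s > 0" for s
  proof -
    have le: "norm (f x) \<le> s / 2 + (norm (f x))\<^sup>2 * (1 / (2 * s))" for x
    proof -
      have "0 \<le> (norm (f x) - s)\<^sup>2" by simp
      hence "2 * s * norm (f x) \<le> s\<^sup>2 + (norm (f x))\<^sup>2" by (simp add: power2_eq_square algebra_simps)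
      thus ?thesis using that by (simp add: power2_eq_square field_simps)
    qed
    have "integral {a..b} (\<lambda>x. norm (f x)) \<le> integral {a..b} (\<lambda>x. s / 2 + (norm (f x))\<^sup>2 * (1 / (2 * s)))"
      using i le by (intro integral_le integrable_add integrable_on_mult_left) auto
    also have "\<dots> = integral {a..b} (\<lambda>x. s / 2) + integral {a..b} (\<lambda>x. (norm (f x))\<^sup>2 * (1 / (2 * s)))"
      using i by (intro integral_add integrable_on_mult_left) auto
    also have "\<dots> = s / 2 * (b - a) + N\<^sup>2 / (2 * s)"
      unfolding N_def L2_norm_on_square[OF f] integral_mult_left using \<open>a \<le> b\<close> by simp
    finally show ?thesis .
  qed
  show ?thesis
  proof (cases "N = 0")
    case True
    have "integral {a..b} (\<lambda>x. norm (f x)) \<le> 0"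
    proof (rule field_le_epsilon)
      fix e :: real assume "e > 0"
      hence "integral {a..b} (\<lambda>x. norm (f x)) \<le> (e / (b - a + 1)) / 2 * (b - a)"
        using key[of "e / (b - a + 1)"] True \<open>a \<le> b\<close> by simp
      also have "\<dots> = e * ((b - a) / (2 * (b - a + 1)))" by simp
      also have "\<dots> \<le> e * 1" using \<open>e > 0\<close> \<open>a \<le> b\<close> by (intro mult_left_mono) (simp_all add: field_simps)
      finally show "integral {a..b} (\<lambda>x. norm (f x)) \<le> 0 + e" by simp
    qed
    thus ?thesis using True by (simp add: N_def)
  next
    case False
    with N have "N > 0" by simp
    have "integral {a..b} (\<lambda>x. norm (f x)) \<le> N / 2 * (b - a) + N\<^sup>2 / (2 * N)" by (rule key[OF \<open>N > 0\<close>])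
    also have "\<dots> = N / 2 * (b - a) + N / 2" using \<open>N > 0\<close> by (simp add: power2_eq_square)
    also have "\<dots> \<le> N / 2 * (b - a) + N / 2 + (N / 2 * (b - a) + N / 2)"
      using mult_nonneg_nonneg[of "N / 2" "b - a"] N \<open>a \<le> b\<close> by linarith
    also have "\<dots> = (b - a + 1) * N" by (simp add: algebra_simps)
    finally show ?thesis by (simp add: N_def)
  qed
qed

lemma L2_norm_on_le:
  assumes "a \<le> b" "B \<ge> 0" and le: "AE x in lebesgue_on {a..b}. norm (g x) \<le> B"
  shows "L2_norm_on a b g \<le> B * sqrt (b - a)"
proof -
  have "(LINT x|lebesgue_on {a..b}. (norm (g x))\<^sup>2) \<le> (LINT x|lebesgue_on {a..b}. B\<^sup>2)"
  proof (rule integral_mono_AE')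
    show "integrable (lebesgue_on {a..b}) (\<lambda>_. B\<^sup>2)"
      by (simp add: integrable_lebesgue_on_iff absolutely_integrable_on_const)
    show "AE x in lebesgue_on {a..b}. (norm (g x))\<^sup>2 \<le> B\<^sup>2"
      using le by eventually_elim (auto intro: power_mono)
  qed auto
  also have "(LINT x|lebesgue_on {a..b}. B\<^sup>2) = integral {a..b} (\<lambda>_. B\<^sup>2)"
    by (intro lebesgue_integral_eq_integral) (simp_all add: integrable_lebesgue_on_iff absolutely_integrable_on_const)
  also have "\<dots> = B\<^sup>2 * (b - a)" using \<open>a \<le> b\<close> by simp
  finally have "L2_norm_on a b g \<le> sqrt (B\<^sup>2 * (b - a))" unfolding L2_norm_on_def by simp
  thus ?thesis using \<open>B \<ge> 0\<close> by (simp add: real_sqrt_mult)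
qed

lemma continuous_on_L2_on:
  assumes "continuous_on {a..b} f"
  shows "f \<in> L2_on a b"
  unfolding L2_on_def mem_Collect_eq
proof
  show "f \<in> borel_measurable (lebesgue_on {a..b})"
    using assms by (intro continuous_imp_measurable_on_sets_lebesgue) auto
  show "integrable (lebesgue_on {a..b}) (\<lambda>x. (norm (f x))\<^sup>2)"
    unfolding integrable_lebesgue_on_iff
    using assms by (intro absolutely_integrable_continuous_real continuous_intros)
qed

lemma L2_on_add:
  assumes f: "f \<in> L2_on a b" and g: "g \<in> L2_on a b"
  shows "(\<lambda>x. f x + g x) \<in> L2_on a b"
  unfolding L2_on_def mem_Collect_eq
proof
  show m: "(\<lambda>x. f x + g x) \<in> borel_measurable (lebesgue_on {a..b})"
    using f g by (auto simp: L2_on_def)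
  have i: "integrable (lebesgue_on {a..b}) (\<lambda>x. 2 * (norm (f x))\<^sup>2 + 2 * (norm (g x))\<^sup>2)"
    using f g by (auto simp: L2_on_def)
  have le: "(norm (f x + g x))\<^sup>2 \<le> 2 * (norm (f x))\<^sup>2 + 2 * (norm (g x))\<^sup>2" for x
  proof -
    have "(norm (f x + g x))\<^sup>2 \<le> (norm (f x) + norm (g x))\<^sup>2"
      by (intro power_mono norm_triangle_ineq) auto
    also have "\<dots> = 2 * (norm (f x))\<^sup>2 + 2 * (norm (g x))\<^sup>2 - (norm (f x) - norm (g x))\<^sup>2"
      by (simp add: power2_eq_square algebra_simps)
    finally show ?thesis using zero_le_power2[of "norm (f x) - norm (g x)"] by linarith
  qed
  show "integrable (lebesgue_on {a..b}) (\<lambda>x. (norm (f x + g x))\<^sup>2)"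
    using m by (intro Bochner_Integration.integrable_bound[OF i]) (auto intro!: always_eventually le)
qed

lemma ae_eq_on_iff: "ae_eq_on a b f g \<longleftrightarrow> (\<exists>N. negligible N \<and> (\<forall>x\<in>{a..b} - N. f x = g x))"
  unfolding ae_eq_on_def by (rule AE_lebesgue_on_iff) simp

text \<open>A nonnegative continuous function with integral 0 vanishes. This recovers pointwise
  values, the endpoints included, from equality almost everywhere.\<close>

lemma continuous_on_ae_zero:
  fixes f :: "real \<Rightarrow> 'a::real_normed_vector"
  assumes "a < b" and f: "continuous_on {a..b} f" and N: "negligible N" "\<And>x. x \<in> {a..b} - N \<Longrightarrow> f x = 0"
    and x: "x \<in> {a..b}"
  shows "f x = 0"
proof -
  have "((\<lambda>x. 0 :: real) has_integral 0) {a..b}" by simp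
  hence "((\<lambda>x. norm (f x)) has_integral 0) {a..b}"
    by (rule has_integral_spike[OF N(1), rotated]) (use N(2) in auto)
  hence "norm (f x) = 0"
    using assms by (intro has_integral_0_cbox_imp_0[of a b "\<lambda>x. norm (f x)"]) (auto intro: continuous_on_norm)
  thus ?thesis by simp
qed

section \<open>The Sturm--Liouville system\<close>

text \<open>The rows are \<open>D[1] y = u\<close> solved for the derivative of \<open>y\<close>,
  and \<open>D[2] y = \<mu> * y + f\<close> solved for the derivative of \<open>u\<close>; the term
  with \<open>f\<close> goes into the source.\<close>

definition SL_matrix :: "(real \<Rightarrow> complex) \<Rightarrow> complex \<Rightarrow> real \<Rightarrow> complex^2^2" where
  "SL_matrix q \<mu> t = vector [vector [q t, 1], vector [- (q t)\<^sup>2 - \<mu>, - q t]]"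

definition SL_source :: "(real \<Rightarrow> complex) \<Rightarrow> real \<Rightarrow> complex^2" where
  "SL_source f t = vector [0, - f t]"

lemma SL_system_rhs:
  "SL_matrix q \<mu> t *v y + SL_source f t =
     vector [q t * y $ 1 + y $ 2, (- (q t)\<^sup>2 - \<mu>) * y $ 1 - q t * y $ 2 - f t]"
  by (simp add: SL_matrix_def SL_source_def vec_eq_iff forall_2 matrix_vector_mult_def sum_2)

lemma SL_matrix_abs_integrable:
  assumes "q \<in> L2_on a b"
  shows "SL_matrix q \<mu> absolutely_integrable_on {a..b}"
proof -
  have "(\<lambda>t. - q t) absolutely_integrable_on {a..b}" "(\<lambda>t. - (q t)\<^sup>2 - \<mu>) absolutely_integrable_on {a..b}"
    using L2_on_abs_integrable(1,2)[OF assms]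
    by (auto intro!: set_integral_diff(1) absolutely_integrable_on_const abs_integrable_minus)
  thus ?thesis
    unfolding SL_matrix_def[abs_def] using L2_on_abs_integrable(1)[OF assms]
    by (intro absolutely_integrable_vector_2 absolutely_integrable_on_const) auto
qed

lemma SL_source_abs_integrable:
  assumes "f \<in> L2_on a b"
  shows "SL_source f absolutely_integrable_on {a..b}"
proof -
  have "(\<lambda>t. - f t) absolutely_integrable_on {a..b}"
    by (intro abs_integrable_minus L2_on_abs_integrable(1) assms)
  thus ?thesis
    unfolding SL_source_def[abs_def]
    by (intro absolutely_integrable_vector_2 absolutely_integrable_on_const) auto
qed

lemma norm_SL_source: "norm (SL_source f t) = norm (f t)"
  by (simp add: SL_source_def norm_vec_def L2_set_def sum_2)

lemma SL_source_zero: "SL_source (\<lambda>_. 0) = (\<lambda>_. 0)"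
  by (auto simp: SL_source_def vec_eq_iff forall_2)

lemma integral_norm_SL_source_le:
  assumes "a \<le> b" "f \<in> L2_on a b"
  shows "integral {a..b} (\<lambda>s. norm (SL_source f s)) \<le> (b - a + 1) * L2_norm_on a b f"
  using integral_norm_le_L2_norm[OF assms] by (simp add: norm_SL_source)

section \<open>Equivalence of the resolvent equation and the boundary problem\<close>

text \<open>Absolute continuity integrates the derivatives known almost everywhere; integrability of
  the right-hand sides is part of what the fundamental theorem yields. \<open>Y\<close> is built
  from the representatives \<open>w\<close> and \<open>u\<close>, since \<open>y\<close> itself is
  fixed only up to a null set and has no meaningful boundary values.\<close>

lemma resolvent_eq_imp_system_solution:
  assumes "a \<le> b" and res: "resolvent_eq a b (SL_operator a b q \<alpha> \<beta>) \<mu> f y"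
  obtains Y where "y \<in> L2_on a b" "ae_eq_on a b y (\<lambda>t. Y t $ 1)"
    "system_solution a b (SL_matrix q \<mu>) (SL_source f) Y" "boundary_form a b \<alpha> \<beta> Y = 0"
proof -
  from res obtain v w u where y: "y \<in> L2_on a b" and yw: "ae_eq_on a b y w"
    and qd: "has_quasi_deriv2 a b q w u v" and bc: "\<alpha> *v vector [w a, u a] + \<beta> *v vector [w b, u b] = 0"
    and vf: "ae_eq_on a b (\<lambda>x. v x - \<mu> * y x) f"
    unfolding resolvent_eq_def SL_operator_def by auto
  obtain N1 where N1: "negligible N1" "\<forall>x\<in>{a..b} - N1. y x = w x"
    using yw unfolding ae_eq_on_iff by auto
  obtain N2 where N2: "negligible N2" "\<forall>x\<in>{a..b} - N2. v x - \<mu> * y x = f x"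
    using vf unfolding ae_eq_on_iff by auto
  obtain N3 where N3: "negligible N3" "\<forall>x\<in>{a..b} - N3.
      \<exists>y'. (w has_vector_derivative y') (at x within {a..b}) \<and> u x = y' - q x * w x"
    using qd unfolding has_quasi_deriv2_def has_quasi_deriv1_def by (auto simp: AE_lebesgue_on_iff)
  obtain N4 where N4: "negligible N4" "\<forall>x\<in>{a..b} - N4.
      \<exists>u'. (u has_vector_derivative u') (at x within {a..b}) \<and> v x = - u' - q x * u x - (q x)\<^sup>2 * w x"
    using qd unfolding has_quasi_deriv2_def by (auto simp: AE_lebesgue_on_iff)
  have ac: "ac_on a b w" "ac_on a b u"
    using qd unfolding has_quasi_deriv2_def has_quasi_deriv1_def abs_cont_on_iff_ac_on by auto
  have iw: "((\<lambda>t. q t * w t + u t) has_integral (w t - w a)) {a..t}" if "t \<in> {a..b}" for t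
  proof (rule ac_on_deriv_has_integral[OF ac(1) N3(1) _ that])
    fix x assume "x \<in> {a..b} - N3"
    then obtain y' where "(w has_vector_derivative y') (at x within {a..b})" "u x = y' - q x * w x"
      using N3(2) by blast
    thus "(w has_vector_derivative q x * w x + u x) (at x within {a..b})" by simp
  qed
  have iu: "((\<lambda>t. (- (q t)\<^sup>2 - \<mu>) * w t - q t * u t - f t) has_integral (u t - u a)) {a..t}" if "t \<in> {a..b}" for t
  proof (rule ac_on_deriv_has_integral[OF ac(2) _ _ that])
    show "negligible (N1 \<union> N2 \<union> N4)" using N1 N2 N4 by (intro negligible_Un)
    fix x assume x: "x \<in> {a..b} - (N1 \<union> N2 \<union> N4)"
    then obtain u' where u': "(u has_vector_derivative u') (at x within {a..b})"
      "v x = - u' - q x * u x - (q x)\<^sup>2 * w x"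
      using N4(2) by blast
    have "f x = v x - \<mu> * w x" using x N1(2) N2(2) by (metis Diff_iff UnI1 UnI2)
    hence "u' = (- (q x)\<^sup>2 - \<mu>) * w x - q x * u x - f x" using u'(2) by algebra
    thus "(u has_vector_derivative (- (q x)\<^sup>2 - \<mu>) * w x - q x * u x - f x) (at x within {a..b})"
      using u'(1) by simp
  qed
  define Y :: "real \<Rightarrow> complex^2" where "Y = (\<lambda>t. vector [w t, u t])"
  have Yn: "Y t $ 1 = w t" "Y t $ 2 = u t" for t by (simp_all add: Y_def)
  have iY: "((\<lambda>s. SL_matrix q \<mu> s *v Y s + SL_source f s) has_integral (Y t - Y a)) {a..t}" if "t \<in> {a..b}" for t
  proof -
    have "Y t - Y a = vector [w t - w a, u t - u a]" by (simp add: Y_def vec_eq_iff forall_2)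
    thus ?thesis unfolding SL_system_rhs Yn using has_integral_vector_2[OF iw[OF that] iu[OF that]] by simp
  qed
  have "system_solution a b (SL_matrix q \<mu>) (SL_source f) Y"
    unfolding system_solution_def
  proof
    show eq: "\<forall>t\<in>{a..b}. Y t = Y a + integral {a..t} (\<lambda>s. SL_matrix q \<mu> s *v Y s + SL_source f s)"
      using integral_unique[OF iY] by auto
    have "continuous_on {a..b} (\<lambda>t. Y a + integral {a..t} (\<lambda>s. SL_matrix q \<mu> s *v Y s + SL_source f s))"
      using iY[of b] \<open>a \<le> b\<close> by (intro continuous_intros indefinite_integral_continuous_1) auto
    thus "continuous_on {a..b} Y" by (rule continuous_on_eq) (rule bspec[OF eq, symmetric])
  qed
  moreover have "boundary_form a b \<alpha> \<beta> Y = 0" using bc by (simp add: boundary_form_def Y_def)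
  moreover have "ae_eq_on a b y (\<lambda>t. Y t $ 1)" using yw by (simp add: Yn)
  ultimately show thesis using y by (intro that[of Y])
qed

text \<open>The increments of a solution are dominated by the integral of \<open>norm (g t)\<close>,
  so its components are absolutely continuous, and Lebesgue differentiation provides both
  quasi-derivatives almost everywhere.\<close>

lemma system_solution_imp_resolvent_eq:
  assumes "a \<le> b" and q: "q \<in> L2_on a b" and f: "f \<in> L2_on a b"
    and Y: "system_solution a b (SL_matrix q \<mu>) (SL_source f) Y" and bc: "boundary_form a b \<alpha> \<beta> Y = 0"
  shows "resolvent_eq a b (SL_operator a b q \<alpha> \<beta>) \<mu> f (\<lambda>t. Y t $ 1)"
proof -
  define g where "g = (\<lambda>s. SL_matrix q \<mu> s *v Y s + SL_source f s)"
  note cY = system_solutionD(1)[OF Y]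
  have g: "g absolutely_integrable_on {a..b}" unfolding g_def
    by (intro set_integral_add(1) absolutely_integrable_matrix_vector_mult SL_matrix_abs_integrable
        SL_source_abs_integrable q f cY)
  have Yt: "Y t = Y a + integral {a..t} g" if "t \<in> {a..b}" for t
    unfolding g_def by (rule system_solutionD(2)[OF Y that])
  have cYi: "continuous_on {a..b} (\<lambda>t. Y t $ i)" for i by (intro continuous_on_component cY)
  have ac: "ac_on a b (\<lambda>t. Y t $ i)" for i
  proof (rule dominated_on_imp_ac_on)
    show "dominated_on a b (\<lambda>t. norm (g t)) (\<lambda>t. Y t $ i)"
      unfolding dominated_on_def
    proof (intro conjI ballI allI impI)
      show "(\<lambda>t. norm (g t)) absolutely_integrable_on {a..b}" using g by (rule set_integrable_norm)
      fix x y assume xy: "a \<le> x \<and> x \<le> y \<and> y \<le> b"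
      have "norm (Y y $ i - Y x $ i) \<le> norm (Y y - Y x)"
        using Finite_Cartesian_Product.norm_nth_le[of "Y y - Y x" i] by simp
      also have "\<dots> = norm (Y a + integral {a..y} g - (Y a + integral {a..x} g))"
        using Yt[of x] Yt[of y] xy by (simp only: atLeastAtMost_iff) simp
      also have "\<dots> \<le> integral {x..y} (\<lambda>t. norm (g t))"
        using dominated_on_integral[OF g, of "Y a"] xy unfolding dominated_on_def by blast
      finally show "norm (Y y $ i - Y x $ i) \<le> integral {x..y} (\<lambda>t. norm (g t))" .
    qed auto
  qed
  obtain N where N: "negligible N" "\<And>x t. t \<le> b \<Longrightarrow> x \<in> {a..t} - N \<Longrightarrow>
      ((\<lambda>t. Y a + integral {a..t} g) has_vector_derivative g x) (at x within {a..t})"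
    by (rule has_vector_derivative_shift_integral[OF g, of "Y a"]) (rule that)
  have deriv: "((\<lambda>t. Y t $ i) has_vector_derivative g x $ i) (at x within {a..b})" if x: "x \<in> {a..b} - N" for x i
  proof -
    have "(Y has_vector_derivative g x) (at x within {a..b})"
      by (rule has_vector_derivative_transform[OF _ _ N(2)[OF order_refl x]]) (rule DiffD1[OF x], erule Yt)
    thus ?thesis by (rule bounded_linear.has_vector_derivative[OF bounded_linear_vec_nth])
  qed
  have gi: "g x $ 1 = q x * Y x $ 1 + Y x $ 2"
    "g x $ 2 = (- (q x)\<^sup>2 - \<mu>) * Y x $ 1 - q x * Y x $ 2 - f x" for x
    unfolding g_def SL_system_rhs by simp_all
  \<comment> \<open>The value of \<open>D[2]\<close> forced by the resolvent equation; it is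
    square-integrable because \<open>f\<close> is and the first component is continuous.\<close>
  define v where "v = (\<lambda>x. f x + \<mu> * Y x $ 1)"
  have v: "v \<in> L2_on a b" unfolding v_def
    by (intro L2_on_add f continuous_on_L2_on continuous_intros cYi)
  have "has_quasi_deriv2 a b q (\<lambda>t. Y t $ 1) (\<lambda>t. Y t $ 2) v"
    unfolding has_quasi_deriv2_def has_quasi_deriv1_def abs_cont_on_iff_ac_on
  proof (intro conjI ac)
    show "AE x in lebesgue_on {a..b}. \<exists>y'. ((\<lambda>t. Y t $ 1) has_vector_derivative y') (at x within {a..b}) \<and>
        Y x $ 2 = y' - q x * Y x $ 1"
    proof (subst AE_lebesgue_on_iff)
      show "\<exists>N. negligible N \<and> (\<forall>x\<in>{a..b} - N. \<exists>y'. ((\<lambda>t. Y t $ 1) has_vector_derivative y') (at x within {a..b}) \<and>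
        Y x $ 2 = y' - q x * Y x $ 1)"
      proof (intro exI[of _ N] conjI N(1) ballI)
        fix x assume "x \<in> {a..b} - N"
        from deriv[OF this, of 1]
        show "\<exists>y'. ((\<lambda>t. Y t $ 1) has_vector_derivative y') (at x within {a..b}) \<and> Y x $ 2 = y' - q x * Y x $ 1"
          by (intro exI[of _ "g x $ 1"]) (simp add: gi)
      qed
    qed simp
    show "AE x in lebesgue_on {a..b}. \<exists>u'. ((\<lambda>t. Y t $ 2) has_vector_derivative u') (at x within {a..b}) \<and>
        v x = - u' - q x * Y x $ 2 - (q x)\<^sup>2 * Y x $ 1"
    proof (subst AE_lebesgue_on_iff)
      show "\<exists>N. negligible N \<and> (\<forall>x\<in>{a..b} - N. \<exists>u'. ((\<lambda>t. Y t $ 2) has_vector_derivative u') (at x within {a..b}) \<and>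
        v x = - u' - q x * Y x $ 2 - (q x)\<^sup>2 * Y x $ 1)"
      proof (intro exI[of _ N] conjI N(1) ballI)
        fix x assume "x \<in> {a..b} - N"
        from deriv[OF this, of 2]
        show "\<exists>u'. ((\<lambda>t. Y t $ 2) has_vector_derivative u') (at x within {a..b}) \<and>
            v x = - u' - q x * Y x $ 2 - (q x)\<^sup>2 * Y x $ 1"
          by (intro exI[of _ "g x $ 2"]) (simp add: gi v_def algebra_simps)
      qed
    qed auto
  qed
  moreover have "vector [Y t $ 1, Y t $ 2] = Y t" for t by (simp add: vec_eq_iff forall_2)
  ultimately have "((\<lambda>t. Y t $ 1), v) \<in> SL_operator a b q \<alpha> \<beta>"
    unfolding SL_operator_def mem_Collect_eq case_prod_conv using v continuous_on_L2_on[OF cYi[of 1]] bc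
    by (intro conjI exI[of _ "\<lambda>t. Y t $ 1"] exI[of _ "\<lambda>t. Y t $ 2"])
      (simp_all add: boundary_form_def ae_eq_on_def)
  moreover have "ae_eq_on a b (\<lambda>x. v x - \<mu> * Y x $ 1) f" by (simp add: ae_eq_on_def v_def)
  ultimately show ?thesis unfolding resolvent_eq_def by blast
qed

text \<open>Existence is solvability of the boundary problem. The a priori bound gives uniqueness,
  when applied to a difference with source 0, as well as boundedness of the inverse.\<close>

lemma in_resolvent_setI:
  assumes "a \<le> b" and q: "q \<in> L2_on a b" and triv: "only_trivial_solution a b (SL_matrix q \<mu>) \<alpha> \<beta>"
  shows "\<mu> \<in> resolvent_set_on a b (SL_operator a b q \<alpha> \<beta>)"
proof -
  note A = SL_matrix_abs_integrable[OF q, of \<mu>]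
  let ?T = "SL_operator a b q \<alpha> \<beta>"
  obtain C where C: "C \<ge> 0"
    "\<And>F Y t. F absolutely_integrable_on {a..b} \<Longrightarrow> system_solution a b (SL_matrix q \<mu>) F Y \<Longrightarrow>
       boundary_form a b \<alpha> \<beta> Y = 0 \<Longrightarrow> t \<in> {a..b} \<Longrightarrow> norm (Y t) \<le> C * integral {a..b} (\<lambda>s. norm (F s))"
    by (rule boundary_problem_bound[OF \<open>a \<le> b\<close> A triv]) (rule that)
  have "\<exists>y. resolvent_eq a b ?T \<mu> f y" if f: "f \<in> L2_on a b" for f
  proof -
    obtain Y where "system_solution a b (SL_matrix q \<mu>) (SL_source f) Y" "boundary_form a b \<alpha> \<beta> Y = 0"
      by (rule boundary_problem_solvable[OF \<open>a \<le> b\<close> A triv SL_source_abs_integrable[OF f]])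
    from system_solution_imp_resolvent_eq[OF \<open>a \<le> b\<close> q f this] show ?thesis by blast
  qed
  moreover have "ae_eq_on a b y z" if f: "f \<in> L2_on a b" and yz: "resolvent_eq a b ?T \<mu> f y" "resolvent_eq a b ?T \<mu> f z" for f y z
  proof -
    obtain Y where Y: "ae_eq_on a b y (\<lambda>t. Y t $ 1)" "system_solution a b (SL_matrix q \<mu>) (SL_source f) Y"
      "boundary_form a b \<alpha> \<beta> Y = 0" by (rule resolvent_eq_imp_system_solution[OF \<open>a \<le> b\<close> yz(1)])
    obtain Z where Z: "ae_eq_on a b z (\<lambda>t. Z t $ 1)" "system_solution a b (SL_matrix q \<mu>) (SL_source f) Z"
      "boundary_form a b \<alpha> \<beta> Z = 0" by (rule resolvent_eq_imp_system_solution[OF \<open>a \<le> b\<close> yz(2)])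
    note F = SL_source_abs_integrable[OF f]
    have "norm (Y t - Z t) \<le> 0" if "t \<in> {a..b}" for t
      using C(2)[OF abs_integrable_zero system_solution_diff[OF A F Y(2) Z(2)] _ that] Y(3) Z(3)
      by (simp add: boundary_form_diff)
    hence YZ: "Y t = Z t" if "t \<in> {a..b}" for t using that by simp
    have "AE x in lebesgue_on {a..b}. y x = Y x $ 1" "AE x in lebesgue_on {a..b}. z x = Z x $ 1"
      using Y(1) Z(1) by (auto simp: ae_eq_on_def)
    moreover have "AE x in lebesgue_on {a..b}. Y x = Z x" using YZ by (intro AE_I2) simp
    ultimately show ?thesis unfolding ae_eq_on_def by eventually_elim simp
  qed
  \<comment> \<open>\<open>b - a + 1\<close> comes from passing to the L1 norm of \<open>f\<close>,
    and \<open>sqrt (b - a)\<close> from passing from the supremum of \<open>y\<close> to its L2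
    norm.\<close>
  moreover have "L2_norm_on a b y \<le> (C * (b - a + 1) * sqrt (b - a)) * L2_norm_on a b f"
    if f: "f \<in> L2_on a b" and y: "resolvent_eq a b ?T \<mu> f y" for f y
  proof -
    obtain Y where Y: "ae_eq_on a b y (\<lambda>t. Y t $ 1)" "system_solution a b (SL_matrix q \<mu>) (SL_source f) Y"
      "boundary_form a b \<alpha> \<beta> Y = 0" by (rule resolvent_eq_imp_system_solution[OF \<open>a \<le> b\<close> y])
    define B where "B = C * ((b - a + 1) * L2_norm_on a b f)"
    have "B \<ge> 0" using C(1) \<open>a \<le> b\<close> by (simp add: B_def L2_norm_on_def integral_nonneg_AE)
    have le: "norm (Y t $ 1) \<le> B" if "t \<in> {a..b}" for t
    proof -
      have "norm (Y t $ 1) \<le> norm (Y t)" by (rule Finite_Cartesian_Product.norm_nth_le)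
      also have "\<dots> \<le> C * integral {a..b} (\<lambda>s. norm (SL_source f s))"
        by (rule C(2)[OF SL_source_abs_integrable[OF f] Y(2,3) that])
      also have "\<dots> \<le> B" unfolding B_def
        by (intro mult_left_mono integral_norm_SL_source_le \<open>a \<le> b\<close> f C(1))
      finally show ?thesis .
    qed
    have "AE x in lebesgue_on {a..b}. norm (Y x $ 1) \<le> B" using le by (intro AE_I2) simp
    hence "AE x in lebesgue_on {a..b}. norm (y x) \<le> B"
      using Y(1) unfolding ae_eq_on_def by eventually_elim simp
    from L2_norm_on_le[OF \<open>a \<le> b\<close> \<open>B \<ge> 0\<close> this] show ?thesis by (simp add: B_def mult_ac)
  qed
  ultimately show ?thesis unfolding resolvent_set_on_def by blast
qed

text \<open>A homogeneous solution and 0 both solve the resolvent equation for \<open>f = 0\<close>,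
  so their first components agree almost everywhere and, by continuity, everywhere. The first row of
  the system then says that all integrals of \<open>Y $ 2\<close> from \<open>a\<close> vanish,
  which forces \<open>Y a $ 2 = 0\<close> on a nondegenerate interval.\<close>

lemma in_resolvent_setD:
  assumes "a < b" and q: "q \<in> L2_on a b" and \<mu>: "\<mu> \<in> resolvent_set_on a b (SL_operator a b q \<alpha> \<beta>)"
  shows "only_trivial_solution a b (SL_matrix q \<mu>) \<alpha> \<beta>"
  unfolding only_trivial_solution_def
proof (intro allI impI)
  let ?T = "SL_operator a b q \<alpha> \<beta>"
  fix Y assume Y: "system_solution a b (SL_matrix q \<mu>) (\<lambda>_. 0) Y \<and> boundary_form a b \<alpha> \<beta> Y = 0"
  have "a \<le> b" using \<open>a < b\<close> by simp
  have zero: "(\<lambda>_. 0) \<in> L2_on a b" by (intro continuous_on_L2_on continuous_intros)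
  have "system_solution a b (SL_matrix q \<mu>) (\<lambda>_. 0) (\<lambda>_. 0)" by (simp add: system_solution_def)
  moreover have "boundary_form a b \<alpha> \<beta> (\<lambda>_. 0) = 0" by (simp add: boundary_form_def)
  ultimately have "resolvent_eq a b ?T \<mu> (\<lambda>_. 0) (\<lambda>t. Y t $ 1)" "resolvent_eq a b ?T \<mu> (\<lambda>_. 0) (\<lambda>t. (0::complex^2) $ 1)"
    using Y by (intro system_solution_imp_resolvent_eq[OF \<open>a \<le> b\<close> q zero, unfolded SL_source_zero]; simp)+
  hence "ae_eq_on a b (\<lambda>t. Y t $ 1) (\<lambda>t. (0::complex^2) $ 1)"
    using \<mu> zero unfolding resolvent_set_on_def by blast
  then obtain N where N: "negligible N" "\<And>x. x \<in> {a..b} - N \<Longrightarrow> Y x $ 1 = 0"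
    unfolding ae_eq_on_iff by auto
  have cY: "continuous_on {a..b} Y" using Y system_solutionD(1) by blast
  have Y1: "Y x $ 1 = 0" if "x \<in> {a..b}" for x
    by (rule continuous_on_ae_zero[OF \<open>a < b\<close> continuous_on_component[OF cY] N that])
  have int0: "integral {a..t} (\<lambda>s. Y s $ 2) = 0" if t: "t \<in> {a..b}" for t
  proof -
    let ?g = "\<lambda>s. SL_matrix q \<mu> s *v Y s + SL_source (\<lambda>_. 0) s"
    have "?g integrable_on {a..t}"
      using t by (intro integrable_on_subinterval_abs(1)[of a b] set_integral_add(1) absolutely_integrable_matrix_vector_mult
          SL_matrix_abs_integrable SL_source_abs_integrable q zero cY) auto
    moreover have "Y t = Y a + integral {a..t} ?g"
      unfolding SL_source_zero using Y by (intro system_solutionD(2)[OF _ t]) simp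
    ultimately have "Y t $ 1 = Y a $ 1 + integral {a..t} (\<lambda>s. ?g s $ 1)"
      by (simp only: vector_add_component integral_vec_nth)
    hence "integral {a..t} (\<lambda>s. ?g s $ 1) = 0" using Y1 t \<open>a \<le> b\<close> by simp
    moreover have "integral {a..t} (\<lambda>s. ?g s $ 1) = integral {a..t} (\<lambda>s. Y s $ 2)"
      using t Y1 by (intro integral_cong) (simp add: SL_system_rhs)
    ultimately show ?thesis by simp
  qed
  \<comment> \<open>The one-sided derivative at \<open>a\<close> is computed in two ways; it is
    unique because \<open>a\<close> is a limit point of \<open>{a..b}\<close>.\<close>
  have "((\<lambda>t. integral {a..t} (\<lambda>s. Y s $ 2)) has_vector_derivative Y a $ 2) (at a within {a..b})"
    using \<open>a \<le> b\<close> by (intro integral_has_vector_derivative continuous_on_component cY) auto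
  moreover have "((\<lambda>t. integral {a..t} (\<lambda>s. Y s $ 2)) has_vector_derivative 0) (at a within {a..b})"
    by (rule has_vector_derivative_transform[OF _ _ has_vector_derivative_const[of 0]]) (use int0 \<open>a \<le> b\<close> in auto)
  ultimately have "Y a $ 2 = 0"
    using \<open>a < b\<close> by (intro vector_derivative_unique_within[of a "{a..b}"]) (auto simp: trivial_limit_within islimpt_Icc)
  thus "Y a = 0" using Y1[of a] \<open>a \<le> b\<close> by (simp add: vec_eq_iff forall_2)
qed

section \<open>From the hypotheses on the potentials to the coefficient matrices and
  resolvents\<close>

text \<open>\<open>sup_norm_on\<close> is a supremum of reals, meaningful only for sets bounded
  above; here the L1 norm of \<open>f\<close> supplies the bound.\<close>

lemma norm_antideriv_le_sup_norm:
  assumes f: "f absolutely_integrable_on {a..b}" and t: "t \<in> {a..b}"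
  shows "norm (integral {a..t} f) \<le> sup_norm_on a b (antideriv a f)"
proof -
  have eq: "antideriv a f x = integral {a..x} f" if "x \<in> {a..b}" for x
    unfolding antideriv_def using that
    by (intro set_lebesgue_integral_eq_integral(2) absolutely_integrable_on_subinterval[OF f]) auto
  have "norm (antideriv a f x) \<le> integral {a..b} (\<lambda>t. norm (f t))" if "x \<in> {a..b}" for x
    unfolding eq[OF that] using norm_shift_integral_le[OF f that, of 0] by simp
  hence "bdd_above ((\<lambda>t. norm (antideriv a f t)) ` {a..b})" by (intro bdd_aboveI2)
  hence "norm (antideriv a f t) \<le> sup_norm_on a b (antideriv a f)"
    unfolding sup_norm_on_def using t by (intro cSUP_upper)
  thus ?thesis by (simp add: eq[OF t])
qed

text \<open>The norm is at most the sum over the entries, and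
  \<open>2 * u \<le> 1 + u\<^sup>2\<close> trades the two diagonal entries for a constant and a
  square. The L2 bound on the potentials thus becomes the L1 bound on the matrices.\<close>

lemma integral_norm_SL_matrix_le:
  assumes "a \<le> b" and q: "q \<in> L2_on a b"
  shows "integral {a..b} (\<lambda>s. norm (SL_matrix q \<mu> s)) \<le> (2 + norm \<mu>) * (b - a) + 2 * (L2_norm_on a b q)\<^sup>2"
proof -
  note i = integrable_on_subinterval_abs(1)[OF L2_on_abs_integrable(3)[OF q] order_refl order_refl]
    integrable_on_subinterval_abs(2)[OF SL_matrix_abs_integrable[OF q] order_refl order_refl, of \<mu>]
  have le: "norm (SL_matrix q \<mu> s) \<le> (2 + norm \<mu>) + 2 * (norm (q s))\<^sup>2" for s
  proof -
    have "norm (SL_matrix q \<mu> s) \<le> norm (SL_matrix q \<mu> s $ 1) + norm (SL_matrix q \<mu> s $ 2)"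
      by (rule norm_vec_2_le)
    also have "norm (SL_matrix q \<mu> s $ 1) \<le> norm (q s) + 1"
      using norm_vec_2_le[of "SL_matrix q \<mu> s $ 1"] by (simp add: SL_matrix_def)
    also have "norm (SL_matrix q \<mu> s $ 2) \<le> norm (- (q s)\<^sup>2 - \<mu>) + norm (q s)"
      using norm_vec_2_le[of "SL_matrix q \<mu> s $ 2"] by (simp add: SL_matrix_def)
    also have "norm (- (q s)\<^sup>2 - \<mu>) \<le> (norm (q s))\<^sup>2 + norm \<mu>"
      using norm_triangle_ineq4[of "- (q s)\<^sup>2" \<mu>] by (simp add: norm_power)
    finally have "norm (SL_matrix q \<mu> s) \<le> 2 * norm (q s) + 1 + (norm (q s))\<^sup>2 + norm \<mu>" by simp
    moreover have "0 \<le> (norm (q s) - 1)\<^sup>2" by simp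
    hence "2 * norm (q s) \<le> 1 + (norm (q s))\<^sup>2" by (simp add: power2_eq_square algebra_simps)
    ultimately show ?thesis by linarith
  qed
  have "integral {a..b} (\<lambda>s. norm (SL_matrix q \<mu> s)) \<le> integral {a..b} (\<lambda>s. (2 + norm \<mu>) + 2 * (norm (q s))\<^sup>2)"
    using i le by (intro integral_le integrable_add integrable_on_mult_right) auto
  also have "\<dots> = integral {a..b} (\<lambda>s. 2 + norm \<mu>) + integral {a..b} (\<lambda>s. 2 * (norm (q s))\<^sup>2)"
    using i by (intro integral_add integrable_on_mult_right) auto
  also have "\<dots> = (2 + norm \<mu>) * (b - a) + 2 * (L2_norm_on a b q)\<^sup>2"
    unfolding L2_norm_on_square[OF q] integral_mult_right using \<open>a \<le> b\<close> by simp
  finally show ?thesis .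
qed

text \<open>The entry 1 and the parameter \<open>\<mu>\<close> cancel. The difference of the
  potentials remains twice on the diagonal, up to sign, and that of their squares once, whence the
  coefficients 2 and 1.\<close>

lemma norm_integral_SL_matrix_diff_le:
  assumes q: "q \<in> L2_on a b" and q0: "q0 \<in> L2_on a b" and t: "t \<in> {a..b}"
  shows "norm (integral {a..t} (\<lambda>s. SL_matrix q \<mu> s - SL_matrix q0 \<mu> s)) \<le>
     2 * sup_norm_on a b (antideriv a (\<lambda>x. q x - q0 x)) + sup_norm_on a b (antideriv a (\<lambda>x. (q x)\<^sup>2 - (q0 x)\<^sup>2))"
proof -
  have d1: "(\<lambda>x. q x - q0 x) absolutely_integrable_on {a..b}"
    by (intro set_integral_diff(1) L2_on_abs_integrable(1) q q0)
  have d2: "(\<lambda>x. (q x)\<^sup>2 - (q0 x)\<^sup>2) absolutely_integrable_on {a..b}"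
    by (intro set_integral_diff(1) L2_on_abs_integrable(2) q q0)
  define u where "u = integral {a..t} (\<lambda>x. q x - q0 x)"
  define w where "w = integral {a..t} (\<lambda>x. (q x)\<^sup>2 - (q0 x)\<^sup>2)"
  have u: "((\<lambda>x. q x - q0 x) has_integral u) {a..t}" and w: "((\<lambda>x. (q x)\<^sup>2 - (q0 x)\<^sup>2) has_integral w) {a..t}"
    unfolding u_def w_def using t integrable_on_subinterval_abs(1)[OF d1] integrable_on_subinterval_abs(1)[OF d2] by auto
  have eq: "SL_matrix q \<mu> s - SL_matrix q0 \<mu> s =
      vector [vector [q s - q0 s, 0], vector [- ((q s)\<^sup>2 - (q0 s)\<^sup>2), - (q s - q0 s)]]" for s
    by (simp add: SL_matrix_def vec_eq_iff forall_2)
  have "integral {a..t} (\<lambda>s. SL_matrix q \<mu> s - SL_matrix q0 \<mu> s) = vector [vector [u, 0], vector [- w, - u]]"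
    unfolding eq by (intro integral_unique has_integral_vector_2 has_integral_neg u w has_integral_0)
  also have "norm \<dots> \<le> (norm u + norm (0::complex)) + (norm (- w) + norm (- u))"
    using norm_vec_2_le[of "vector [vector [u, 0], vector [- w, - u]] :: complex^2^2"]
      norm_vec_2_le[of "vector [u, 0] :: complex^2"] norm_vec_2_le[of "vector [- w, - u] :: complex^2"] by simp
  also have "\<dots> = 2 * norm u + norm w" by simp
  also have "\<dots> \<le> 2 * sup_norm_on a b (antideriv a (\<lambda>x. q x - q0 x)) + sup_norm_on a b (antideriv a (\<lambda>x. (q x)\<^sup>2 - (q0 x)\<^sup>2))"
    using norm_antideriv_le_sup_norm[OF d1 t] norm_antideriv_le_sup_norm[OF d2 t] by (simp add: u_def w_def)
  finally show ?thesis .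
qed

lemma resolvent_on_eq:
  assumes "\<mu> \<in> resolvent_set_on a b T" "f \<in> L2_on a b"
  shows "resolvent_eq a b T \<mu> f (resolvent_on a b T \<mu> f)"
proof -
  have "\<exists>y. resolvent_eq a b T \<mu> f y" using assms unfolding resolvent_set_on_def by auto
  thus ?thesis unfolding resolvent_on_def by (rule someI_ex)
qed

text \<open>For each \<open>f\<close> both resolvents are first components of solutions with the
  same source, so \<open>c\<close> bounds their difference uniformly on the interval. The last
  factors pass from L2 to L1 for \<open>f\<close> and from supremum to L2 for the
  difference.\<close>

lemma L2_opnorm_resolvent_diff_le:
  assumes "a \<le> b" and "c \<ge> 0"
    and \<mu>: "\<mu> \<in> resolvent_set_on a b (SL_operator a b q \<alpha> \<beta>)" "\<mu> \<in> resolvent_set_on a b (SL_operator a b q0 \<alpha>0 \<beta>0)"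
    and c: "\<And>F Y Y0 t. F absolutely_integrable_on {a..b} \<Longrightarrow>
       system_solution a b (SL_matrix q \<mu>) F Y \<Longrightarrow> boundary_form a b \<alpha> \<beta> Y = 0 \<Longrightarrow>
       system_solution a b (SL_matrix q0 \<mu>) F Y0 \<Longrightarrow> boundary_form a b \<alpha>0 \<beta>0 Y0 = 0 \<Longrightarrow> t \<in> {a..b} \<Longrightarrow>
       norm (Y t - Y0 t) \<le> c * integral {a..b} (\<lambda>s. norm (F s))"
  shows "L2_opnorm a b (\<lambda>f x. resolvent_on a b (SL_operator a b q \<alpha> \<beta>) \<mu> f x -
           resolvent_on a b (SL_operator a b q0 \<alpha>0 \<beta>0) \<mu> f x) \<le> ennreal (c * ((b - a + 1) * sqrt (b - a)))"
  unfolding L2_opnorm_def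
proof (rule SUP_least, rule ennreal_leI)
  fix f assume "f \<in> {f \<in> L2_on a b. L2_norm_on a b f \<le> 1}"
  hence f: "f \<in> L2_on a b" and f1: "L2_norm_on a b f \<le> 1" by auto
  define y where "y = resolvent_on a b (SL_operator a b q \<alpha> \<beta>) \<mu> f"
  define z where "z = resolvent_on a b (SL_operator a b q0 \<alpha>0 \<beta>0) \<mu> f"
  obtain Y where Y: "ae_eq_on a b y (\<lambda>t. Y t $ 1)" "system_solution a b (SL_matrix q \<mu>) (SL_source f) Y"
    "boundary_form a b \<alpha> \<beta> Y = 0"
    unfolding y_def by (rule resolvent_eq_imp_system_solution[OF \<open>a \<le> b\<close> resolvent_on_eq[OF \<mu>(1) f]])
  obtain Z where Z: "ae_eq_on a b z (\<lambda>t. Z t $ 1)" "system_solution a b (SL_matrix q0 \<mu>) (SL_source f) Z"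
    "boundary_form a b \<alpha>0 \<beta>0 Z = 0"
    unfolding z_def by (rule resolvent_eq_imp_system_solution[OF \<open>a \<le> b\<close> resolvent_on_eq[OF \<mu>(2) f]])
  have le: "norm (Y t $ 1 - Z t $ 1) \<le> c * (b - a + 1)" if t: "t \<in> {a..b}" for t
  proof -
    have "norm (Y t $ 1 - Z t $ 1) \<le> norm (Y t - Z t)"
      using Finite_Cartesian_Product.norm_nth_le[of "Y t - Z t" 1] by simp
    also have "\<dots> \<le> c * integral {a..b} (\<lambda>s. norm (SL_source f s))"
      by (rule c[OF SL_source_abs_integrable[OF f] Y(2,3) Z(2,3) t])
    also have "\<dots> \<le> c * ((b - a + 1) * L2_norm_on a b f)"
      by (intro mult_left_mono integral_norm_SL_source_le \<open>a \<le> b\<close> f \<open>c \<ge> 0\<close>)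
    also have "\<dots> \<le> c * ((b - a + 1) * 1)"
      using f1 \<open>a \<le> b\<close> \<open>c \<ge> 0\<close> by (intro mult_left_mono) auto
    finally show ?thesis by simp
  qed
  have "AE x in lebesgue_on {a..b}. norm (Y x $ 1 - Z x $ 1) \<le> c * (b - a + 1)"
    using le by (intro AE_I2) simp
  hence "AE x in lebesgue_on {a..b}. norm (y x - z x) \<le> c * (b - a + 1)"
    using Y(1) Z(1) unfolding ae_eq_on_def by eventually_elim simp
  moreover have "0 \<le> c * (b - a + 1)" using \<open>a \<le> b\<close> \<open>c \<ge> 0\<close> by simp
  ultimately have "L2_norm_on a b (\<lambda>x. y x - z x) \<le> c * (b - a + 1) * sqrt (b - a)"
    by (intro L2_norm_on_le \<open>a \<le> b\<close>)
  thus "L2_norm_on a b (\<lambda>x. resolvent_on a b (SL_operator a b q \<alpha> \<beta>) \<mu> f x -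
           resolvent_on a b (SL_operator a b q0 \<alpha>0 \<beta>0) \<mu> f x) \<le> c * ((b - a + 1) * sqrt (b - a))"
    by (simp add: y_def z_def mult.assoc)
qed

theorem theorem2:
  fixes a b \<epsilon>\<^sub>0 :: real
    and q :: "real \<Rightarrow> real \<Rightarrow> complex"
    and \<alpha> \<beta> :: "real \<Rightarrow> complex^2^2"
  assumes "a < b"
    and "\<epsilon>\<^sub>0 > 0"
    and "\<And>\<epsilon>. \<epsilon> \<in> {0..\<epsilon>\<^sub>0} \<Longrightarrow> q \<epsilon> \<in> L2_on a b"
    and "resolvent_set_on a b (SL_operator a b (q 0) (\<alpha> 0) (\<beta> 0)) \<noteq> {}"
    and "(\<lambda>\<epsilon>. L2_norm_on a b (q \<epsilon>)) \<in> O[at_right 0](\<lambda>_. 1)"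
    and "((\<lambda>\<epsilon>. sup_norm_on a b (antideriv a (\<lambda>x. q \<epsilon> x - q 0 x))) \<longlongrightarrow> 0) (at_right 0)"
    and "((\<lambda>\<epsilon>. sup_norm_on a b (antideriv a (\<lambda>x. (q \<epsilon> x)\<^sup>2 - (q 0 x)\<^sup>2))) \<longlongrightarrow> 0) (at_right 0)"
    and "(\<alpha> \<longlongrightarrow> \<alpha> 0) (at_right 0)"
    and "(\<beta> \<longlongrightarrow> \<beta> 0) (at_right 0)"
  shows "norm_resolvent_convergent a b
           (\<lambda>\<epsilon>. SL_operator a b (q \<epsilon>) (\<alpha> \<epsilon>) (\<beta> \<epsilon>)) (SL_operator a b (q 0) (\<alpha> 0) (\<beta> 0))"
proof -
  let ?L = "\<lambda>\<epsilon>. SL_operator a b (q \<epsilon>) (\<alpha> \<epsilon>) (\<beta> \<epsilon>)"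
  have "a \<le> b" using assms(1) by simp
  obtain \<mu> where \<mu>: "\<mu> \<in> resolvent_set_on a b (?L 0)" using assms(4) by blast
  have q0: "q 0 \<in> L2_on a b" using assms(2,3) by simp
  have qL2: "\<forall>\<^sub>F \<epsilon> in at_right 0. q \<epsilon> \<in> L2_on a b"
    unfolding eventually_at_right_field using assms(2,3) by (intro exI[of _ \<epsilon>\<^sub>0]) auto
  obtain B where "B > 0" and "\<forall>\<^sub>F \<epsilon> in at_right 0. norm (L2_norm_on a b (q \<epsilon>)) \<le> B * norm (1::real)"
    using landau_o.bigE[OF assms(5)] by metis
  hence B: "\<forall>\<^sub>F \<epsilon> in at_right 0. \<bar>L2_norm_on a b (q \<epsilon>)\<bar> \<le> B" by simp
  define r where "r = (\<lambda>\<epsilon>. 2 * sup_norm_on a b (antideriv a (\<lambda>x. q \<epsilon> x - q 0 x)) +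
    sup_norm_on a b (antideriv a (\<lambda>x. (q \<epsilon> x)\<^sup>2 - (q 0 x)\<^sup>2)))"
  have r: "(r \<longlongrightarrow> 0) (at_right 0)"
    unfolding r_def using assms(6,7) by (auto intro!: tendsto_eq_intros)
  have A: "\<forall>\<^sub>F \<epsilon> in at_right 0. SL_matrix (q \<epsilon>) \<mu> absolutely_integrable_on {a..b}"
    using qL2 by eventually_elim (rule SL_matrix_abs_integrable)
  have K: "\<forall>\<^sub>F \<epsilon> in at_right 0. integral {a..b} (\<lambda>s. norm (SL_matrix (q \<epsilon>) \<mu> s)) \<le>
      (2 + norm \<mu>) * (b - a) + 2 * B\<^sup>2"
    using qL2 B
  proof eventually_elim
    case (elim \<epsilon>)
    have "(L2_norm_on a b (q \<epsilon>))\<^sup>2 \<le> B\<^sup>2" using elim(2) \<open>B > 0\<close> by (simp add: abs_le_square_iff[symmetric])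
    with integral_norm_SL_matrix_le[OF \<open>a \<le> b\<close> elim(1), of \<mu>] show ?case by linarith
  qed
  have R: "\<forall>\<^sub>F \<epsilon> in at_right 0. \<forall>t\<in>{a..b}.
      norm (integral {a..t} (\<lambda>s. SL_matrix (q \<epsilon>) \<mu> s - SL_matrix (q 0) \<mu> s)) \<le> r \<epsilon>"
    using qL2 unfolding r_def by eventually_elim (intro ballI norm_integral_SL_matrix_diff_le q0)
  obtain c where c: "(c \<longlongrightarrow> 0) (at_right 0)"
    and triv: "\<forall>\<^sub>F \<epsilon> in at_right 0. only_trivial_solution a b (SL_matrix (q \<epsilon>) \<mu>) (\<alpha> \<epsilon>) (\<beta> \<epsilon>)"
    and diff: "\<forall>\<^sub>F \<epsilon> in at_right 0. \<forall>F Y Y0. F absolutely_integrable_on {a..b} \<longrightarrow>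
       system_solution a b (SL_matrix (q \<epsilon>) \<mu>) F Y \<longrightarrow> boundary_form a b (\<alpha> \<epsilon>) (\<beta> \<epsilon>) Y = 0 \<longrightarrow>
       system_solution a b (SL_matrix (q 0) \<mu>) F Y0 \<longrightarrow> boundary_form a b (\<alpha> 0) (\<beta> 0) Y0 = 0 \<longrightarrow>
       (\<forall>t\<in>{a..b}. norm (Y t - Y0 t) \<le> c \<epsilon> * integral {a..b} (\<lambda>s. norm (F s)))"
    by (rule boundary_problem_convergence[OF \<open>a \<le> b\<close> SL_matrix_abs_integrable[OF q0]
          in_resolvent_setD[OF assms(1) q0 \<mu>] A K r R assms(8,9)])
  have res: "\<forall>\<^sub>F \<epsilon> in at_right 0. \<mu> \<in> resolvent_set_on a b (?L \<epsilon>)"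
    using qL2 triv by eventually_elim (rule in_resolvent_setI[OF \<open>a \<le> b\<close>])
  let ?D = "\<lambda>\<epsilon>. L2_opnorm a b (\<lambda>f x. resolvent_on a b (?L \<epsilon>) \<mu> f x - resolvent_on a b (?L 0) \<mu> f x)"
  \<comment> \<open>The sign of the rate \<open>c\<close> is not known, and \<open>ennreal\<close>
    sends negative reals to 0; the absolute value gives a genuine nonnegative bound.\<close>
  have le: "\<forall>\<^sub>F \<epsilon> in at_right 0. ?D \<epsilon> \<le> ennreal (\<bar>c \<epsilon>\<bar> * ((b - a + 1) * sqrt (b - a)))"
    using res diff
  proof eventually_elim
    case (elim \<epsilon>)
    show ?case
    proof (rule L2_opnorm_resolvent_diff_le[OF \<open>a \<le> b\<close> abs_ge_zero elim(1) \<mu>])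
      fix F Y Y0 t
      assume hyp: "F absolutely_integrable_on {a..b}" "system_solution a b (SL_matrix (q \<epsilon>) \<mu>) F Y"
        "boundary_form a b (\<alpha> \<epsilon>) (\<beta> \<epsilon>) Y = 0" "system_solution a b (SL_matrix (q 0) \<mu>) F Y0"
        "boundary_form a b (\<alpha> 0) (\<beta> 0) Y0 = 0" "t \<in> {a..b}"
      have "norm (Y t - Y0 t) \<le> c \<epsilon> * integral {a..b} (\<lambda>s. norm (F s))"
        using elim(2) hyp by blast
      also have "\<dots> \<le> \<bar>c \<epsilon>\<bar> * integral {a..b} (\<lambda>s. norm (F s))"
        using integral_nonneg[OF integrable_on_subinterval_abs(2)[OF hyp(1) order_refl order_refl]]
        by (intro mult_right_mono) auto
      finally show "norm (Y t - Y0 t) \<le> \<bar>c \<epsilon>\<bar> * integral {a..b} (\<lambda>s. norm (F s))" .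
    qed
  qed
  have "((\<lambda>\<epsilon>. \<bar>c \<epsilon>\<bar> * ((b - a + 1) * sqrt (b - a))) \<longlongrightarrow> 0) (at_right 0)"
    using c by (auto intro!: tendsto_eq_intros)
  hence "((\<lambda>\<epsilon>. ennreal (\<bar>c \<epsilon>\<bar> * ((b - a + 1) * sqrt (b - a)))) \<longlongrightarrow> 0) (at_right 0)"
    using tendsto_ennrealI by fastforce
  hence "(?D \<longlongrightarrow> 0) (at_right 0)"
    by (intro tendsto_sandwich[OF _ le tendsto_const]) auto
  thus ?thesis unfolding norm_resolvent_convergent_def using \<mu> res by blast
qed

end
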